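(* Let $G=(V,E)$ be a DAG. Then: (1) For $i\in V$ and $A\subseteq V\setminus\{i\}$: $\omega_{i|A}(\phi_G(\Omega,\Lambda))=\omega_i$ for all parameters $(\Omega,\Lambda)$ if and only if $\mathrm{pa}(i)\subseteq A\subseteq V\setminus\overline{\mathrm{de}}(i)$. (2) If $i\neq j$ and $ij\notin E$, then $\lambda_{ij|A}(\Sigma)=0$ for every $\Sigma\in\mathcal M(G)$ if and only if $A\setminus\{i\}$ d-separates $i$ and $j$ in $G$. (3) If $ij\in E$, then $\lambda_{ij|A}(\phi_G(\Omega,\Lambda))=\lambda_{ij}$ for all parameters $(\Omega,\Lambda)$ if and only if $i\in A\subseteq V\setminus\overline{\mathrm{de}}(j)$ and $A\setminus\{i\}$ d-separates $i$ and $j$ in the graph $G_{ij}$ obtained from $G$ by deleting the edge $ij$ and all vertices in $\mathrm{de}(j)$.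
   Context: $G=(V,E)$ is a DAG, edges $i\to j$ written $ij$; $\mathrm{pa}(j)$ parents, $\mathrm{de}(j)$ descendants of $j$ (excluding $j$), $\overline{\mathrm{de}}(j)=\{j\}\cup\mathrm{de}(j)$. Parameters: $\Omega=\mathrm{diag}(\omega_i)_{i\in V}$ with $\omega_i>0$, and $\Lambda=(\lambda_{ij})\in\mathbb R^{V\times V}$ with $\lambda_{ij}=0$ whenever $ij\notin E$. $\phi_G(\Omega,\Lambda)=(I-\Lambda)^{-T}\Omega(I-\Lambda)^{-1}$ and $\mathcal M(G)$ is the image of $\phi_G$ (a set of positive definite matrices). For $\Sigma$ symmetric, $\Sigma_A$ is the principal submatrix on $A$, and for $K\subseteq V\setminus\{i,j\}$, $\Sigma_{ij|K}$ is the submatrix with rows ordered $(i,K)$ and columns $(j,K)$ (same order of $K$); $|\cdot|$ is determinant. Define $\omega_{i|A}(\Sigma)=|\Sigma_{\{i\}\cup A}|/|\Sigma_A|$ and $\lambda_{ij|A}(\Sigma)=|\Sigma_{ij|A\setminus\{i\}}|/|\Sigma_A|$. d-separation: for disjoint $I,J,K$, $K$ d-separates $I$ and $J$ if every path between a vertex of $I$ and one of $J$ contains either a non-collider in $K$ or a collider that is not in $K$ and has no descendant in $K$. *)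

theory Defs
  imports "HOL-Analysis.Analysis"
begin

text \<open>Vertices of the DAG are the elements of a finite type 'n (V = UNIV);
  the edge set E is a relation on 'n; an edge i -> j is the pair (i,j).
  Matrices are real^'n^'n, entry (i,j) is M$i$j.\<close>

definition pa :: "('n \<times> 'n) set \<Rightarrow> 'n \<Rightarrow> 'n set" where
  "pa E j = {k. (k, j) \<in> E}"

definition de :: "('n \<times> 'n) set \<Rightarrow> 'n \<Rightarrow> 'n set" where
  "de E j = {k. (j, k) \<in> E\<^sup>+}"

definition deb :: "('n \<times> 'n) set \<Rightarrow> 'n \<Rightarrow> 'n set" where
  "deb E j = insert j (de E j)"

definition params :: "('n \<times> 'n) set \<Rightarrow> ('n \<Rightarrow> real) \<Rightarrow> real^'n^'n \<Rightarrow> bool" where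
  "params E \<omega> \<Lambda> \<longleftrightarrow> (\<forall>i. \<omega> i > 0) \<and> (\<forall>i j. (i, j) \<notin> E \<longrightarrow> \<Lambda> $ i $ j = 0)"

definition diagm :: "('n::finite \<Rightarrow> real) \<Rightarrow> real^'n^'n" where
  "diagm \<omega> = (\<chi> i j. if i = j then \<omega> i else 0)"

definition phiG :: "('n::finite \<Rightarrow> real) \<Rightarrow> real^'n^'n \<Rightarrow> real^'n^'n" where
  "phiG \<omega> \<Lambda> = transpose (matrix_inv (mat 1 - \<Lambda>)) ** diagm \<omega> ** matrix_inv (mat 1 - \<Lambda>)"

definition modelG :: "('n::finite \<times> 'n) set \<Rightarrow> (real^'n^'n) set" where
  "modelG E = {phiG \<omega> \<Lambda> | \<omega> \<Lambda>. params E \<omega> \<Lambda>}"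

text \<open>Determinant of the square submatrix with rows indexed by R and columns indexed by
  tau ` R, where row r is paired with column tau r (this fixes the common ordering).\<close>
definition gdet :: "('n \<Rightarrow> 'n) \<Rightarrow> 'n set \<Rightarrow> real^'n^'n \<Rightarrow> real" where
  "gdet \<tau> R M = (\<Sum>p\<in>{p. p permutes R}. of_int (sign p) * (\<Prod>r\<in>R. M $ r $ (\<tau> (p r))))"

definition pdet :: "'n set \<Rightarrow> real^'n^'n \<Rightarrow> real" where
  "pdet A M = gdet id A M"

text \<open>|Sigma_{ij|K}|: rows ordered (i,K), columns ordered (j,K).\<close>
definition cdet :: "'n \<Rightarrow> 'n \<Rightarrow> 'n set \<Rightarrow> real^'n^'n \<Rightarrow> real" where
  "cdet i j K M = gdet (\<lambda>r. if r = i then j else r) (insert i K) M"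

definition omega_c :: "'n \<Rightarrow> 'n set \<Rightarrow> real^'n^'n \<Rightarrow> real" where
  "omega_c i A M = pdet (insert i A) M / pdet A M"

definition lambda_c :: "'n \<Rightarrow> 'n \<Rightarrow> 'n set \<Rightarrow> real^'n^'n \<Rightarrow> real" where
  "lambda_c i j A M = cdet i j (A - {i}) M / pdet A M"

definition is_path :: "('n \<times> 'n) set \<Rightarrow> 'n list \<Rightarrow> bool" where
  "is_path E xs \<longleftrightarrow> xs \<noteq> [] \<and> distinct xs \<and>
     (\<forall>k. Suc k < length xs \<longrightarrow> (xs ! k, xs ! Suc k) \<in> E \<or> (xs ! Suc k, xs ! k) \<in> E)"

definition collider :: "('n \<times> 'n) set \<Rightarrow> 'n list \<Rightarrow> nat \<Rightarrow> bool" where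
  "collider E xs k \<longleftrightarrow> (xs ! (k - 1), xs ! k) \<in> E \<and> (xs ! Suc k, xs ! k) \<in> E"

definition blocked :: "('n \<times> 'n) set \<Rightarrow> 'n set \<Rightarrow> 'n list \<Rightarrow> bool" where
  "blocked E K xs \<longleftrightarrow> (\<exists>k. 0 < k \<and> Suc k < length xs \<and>
     ((\<not> collider E xs k \<and> xs ! k \<in> K) \<or>
      (collider E xs k \<and> xs ! k \<notin> K \<and> de E (xs ! k) \<inter> K = {})))"

definition dsep :: "('n \<times> 'n) set \<Rightarrow> 'n set \<Rightarrow> 'n set \<Rightarrow> 'n set \<Rightarrow> bool" where
  "dsep E K I J \<longleftrightarrow> (\<forall>xs. is_path E xs \<and> hd xs \<in> I \<and> last xs \<in> J \<longrightarrow> blocked E K xs)"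

definition Gdel :: "('n \<times> 'n) set \<Rightarrow> 'n \<Rightarrow> 'n \<Rightarrow> ('n \<times> 'n) set" where
  "Gdel E i j = {(x, y). (x, y) \<in> E \<and> (x, y) \<noteq> (i, j) \<and> x \<notin> de E j \<and> y \<notin> de E j}"

end

theory Submission
  imports Defs "HOL-Computational_Algebra.Polynomial"
begin

text \<open>Both quantities are conditional covariances: \<open>\<omega>\<^sub>i\<^sub>|\<^sub>A\<close> is the residual variance of \<open>i\<close> given
  \<open>A\<close>, and \<open>\<lambda>\<^sub>i\<^sub>j\<^sub>|\<^sub>A\<close> is the conditional covariance of \<open>i\<close> and \<open>j\<close> given \<open>K = A - {i}\<close>, divided by
  the residual variance of \<open>i\<close> given \<open>K\<close> if \<open>i \<in> A\<close>.

  Part (2) says that the conditional covariance of \<open>a\<close> and \<open>b\<close> given \<open>K\<close> is not identically zero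
  on the model exactly if \<open>a\<close> and \<open>b\<close> are d-connected given \<open>K\<close>. Removing a sink \<open>v\<close> yields the
  same recursion for both properties. If \<open>v = b\<close>, linearity in \<open>X\<^sub>v\<close> replaces \<open>v\<close> by its parents.
  If \<open>v \<in> K\<close>, then \<open>\<sigma>\<^sub>a\<^sub>b\<^sub>|\<^sub>K = \<sigma>\<^sub>a\<^sub>b\<^sub>|\<^sub>K\<^sub>' - \<sigma>\<^sub>a\<^sub>v\<^sub>|\<^sub>K\<^sub>' \<sigma>\<^sub>v\<^sub>b\<^sub>|\<^sub>K\<^sub>' / \<sigma>\<^sub>v\<^sub>v\<^sub>|\<^sub>K\<^sub>'\<close> with \<open>K' = K - {v}\<close>,
  which is generically nonzero iff \<open>\<sigma>\<^sub>a\<^sub>b\<^sub>|\<^sub>K\<^sub>'\<close> is, or \<open>\<sigma>\<^sub>a\<^sub>p\<^sub>|\<^sub>K\<^sub>'\<close> and \<open>\<sigma>\<^sub>q\<^sub>b\<^sub>|\<^sub>K\<^sub>'\<close> are for some parents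
  \<open>p, q\<close> of \<open>v\<close>; two generically nonzero expressions are nonzero simultaneously because they are
  polynomial along segments in the parameter space.

  If \<open>A\<close> contains \<open>i\<close> but neither \<open>j\<close> nor a descendant of \<open>j\<close>, then
  \<open>\<lambda>\<^sub>i\<^sub>j\<^sub>|\<^sub>A - \<lambda>\<^sub>i\<^sub>j\<close> is the coefficient \<open>\<lambda>\<^sub>i\<^sub>j\<^sub>|\<^sub>A\<close> of the graph \<open>Gdel E i j\<close>, so (3) reduces to (2).
  The remaining necessity claims are refuted by a single edge or a directed chain.\<close>

section \<open>Conditional covariances\<close>

text \<open>Padding with the identity outside \<open>R\<close> makes the row operations for
  \<open>det\<close> available: a permutation that moves a point outside \<open>R\<close> meets a
  zero entry there.\<close>

lemma gdet_eq_det: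
  fixes M :: "real^'n^'n"
  shows "gdet \<tau> R M =
    det (\<chi> r c. if r \<in> R \<and> c \<in> R then M $ r $ \<tau> c else if r = c then 1 else 0)"
proof -
  let ?N = "\<chi> r c. if r \<in> R \<and> c \<in> R then M $ r $ \<tau> c else if r = c then 1 else (0::real)"
  have eq: "(\<Prod>r\<in>R. M $ r $ \<tau> (p r)) = (\<Prod>r\<in>UNIV. ?N $ r $ p r)" if p: "p permutes R" for p
  proof -
    have "(\<Prod>r\<in>UNIV. ?N $ r $ p r) = (\<Prod>r\<in>R. ?N $ r $ p r)"
      by (rule prod.mono_neutral_right) (use p in \<open>auto simp: permutes_def\<close>)
    also have "\<dots> = (\<Prod>r\<in>R. M $ r $ \<tau> (p r))"
      by (rule prod.cong) (use permutes_in_image[OF p] in auto)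
    finally show ?thesis by simp
  qed
  have "det ?N = (\<Sum>p\<in>{p. p permutes R}. of_int (sign p) * (\<Prod>r\<in>UNIV. ?N $ r $ p r))"
    unfolding det_def
  proof (rule sum.mono_neutral_right)
    show "finite {p. p permutes (UNIV::'n set)}" by (simp add: finite_permutations)
    show "{p. p permutes R} \<subseteq> {p. p permutes UNIV}" using permutes_subset by blast
    show "\<forall>p\<in>{p. p permutes UNIV} - {p. p permutes R}.
            of_int (sign p) * (\<Prod>r\<in>UNIV. ?N $ r $ p r) = 0"
    proof
      fix p assume "p \<in> {p. p permutes UNIV} - {p. p permutes R}"
      then obtain x where "x \<notin> R" "p x \<noteq> x" unfolding permutes_def by blast
      then have "?N $ x $ p x = 0" by simp
      then have "(\<Prod>r\<in>UNIV. ?N $ r $ p r) = 0" by (meson UNIV_I finite prod_zero)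
      then show "of_int (sign p) * (\<Prod>r\<in>UNIV. ?N $ r $ p r) = 0" by simp
    qed
  qed
  then show ?thesis unfolding gdet_def using eq by simp
qed

definition spd :: "real^'n^'n \<Rightarrow> bool" where
  "spd M \<longleftrightarrow> (\<forall>x y. M $ x $ y = M $ y $ x) \<and> (\<forall>x. x \<noteq> 0 \<longrightarrow> x \<bullet> (M *v x) > 0)"

text \<open>For a covariance matrix \<open>M\<close> of \<open>X\<close>, the vector \<open>u\<close> holds the coefficients of the residual
  of the regression of \<open>X\<^sub>a\<close> on \<open>X\<^sub>K\<close>, and \<open>M *v u\<close> the covariances of this residual with \<open>X\<close>.\<close>
definition is_resid :: "real^'n^'n \<Rightarrow> 'n set \<Rightarrow> 'n \<Rightarrow> real^'n \<Rightarrow> bool" where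
  "is_resid M K a u \<longleftrightarrow> u $ a = 1 \<and> (\<forall>x. x \<noteq> a \<and> x \<notin> K \<longrightarrow> u $ x = 0) \<and>
     (\<forall>k\<in>K. (M *v u) $ k = 0)"

text \<open>\<open>SOME\<close> is harmless: by \<open>ccov_eq\<close>, all residual vectors of a
  positive definite \<open>M\<close> give the same value when \<open>a\<close> is outside
  \<open>K\<close>.\<close>

definition ccov :: "real^'n^'n \<Rightarrow> 'n set \<Rightarrow> 'n \<Rightarrow> 'n \<Rightarrow> real" where
  "ccov M K a b = (M *v (SOME u. is_resid M K a u)) $ b"

section \<open>Residual vectors and the recursion in the conditioning set\<close>

lemma spd_sym: "spd M \<Longrightarrow> M $ x $ y = M $ y $ x"
  by (simp add: spd_def)

lemma spd_inner_commute:
  assumes "spd M" shows "x \<bullet> (M *v y) = y \<bullet> (M *v x)"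
proof -
  have "x \<bullet> (M *v y) = (\<Sum>i\<in>UNIV. \<Sum>j\<in>UNIV. x$i * (M$i$j * y$j))"
    by (simp add: inner_vec_def matrix_vector_mult_def sum_distrib_left)
  also have "\<dots> = (\<Sum>j\<in>UNIV. \<Sum>i\<in>UNIV. x$i * (M$i$j * y$j))" by (rule sum.swap)
  also have "\<dots> = (\<Sum>j\<in>UNIV. \<Sum>i\<in>UNIV. y$j * (M$j$i * x$i))"
    by (intro sum.cong refl) (metis spd_sym[OF assms] mult.commute mult.left_commute)
  also have "\<dots> = y \<bullet> (M *v x)"
    by (simp add: inner_vec_def matrix_vector_mult_def sum_distrib_left)
  finally show ?thesis .
qed

lemma resid_inner:
  assumes "is_resid M K a u" "a \<notin> K" "\<And>k. k \<in> K \<Longrightarrow> y $ k = 0"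
  shows "u \<bullet> y = y $ a"
proof -
  have "u \<bullet> y = (\<Sum>x\<in>UNIV. if x = a then y $ a else 0)"
    unfolding inner_vec_def
    by (intro sum.cong refl) (use assms in \<open>auto simp: is_resid_def\<close>)
  then show ?thesis by simp
qed

text \<open>Both sides equal \<open>u \<bullet> (M *v w)\<close>: by \<open>resid_inner\<close>, a
  residual vector evaluates any vector vanishing on \<open>K\<close> at its own index.\<close>

lemma resid_sym:
  assumes "spd M" "is_resid M K a u" "is_resid M K b w" "a \<notin> K" "b \<notin> K"
  shows "(M *v u) $ b = (M *v w) $ a"
  using resid_inner[OF assms(2,4), of "M *v w"] resid_inner[OF assms(3,5), of "M *v u"]
    spd_inner_commute[OF assms(1), of u w] assms(2,3)
  by (auto simp: is_resid_def)

lemma resid_pos: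
  assumes "spd M" "is_resid M K a u" "a \<notin> K"
  shows "(M *v u) $ a > 0"
proof -
  have "u \<noteq> 0" using assms(2) by (auto simp: is_resid_def)
  then have "u \<bullet> (M *v u) > 0" using assms(1) by (simp add: spd_def)
  moreover have "u \<bullet> (M *v u) = (M *v u) $ a"
    by (rule resid_inner[OF assms(2,3)]) (use assms(2) in \<open>simp add: is_resid_def\<close>)
  ultimately show ?thesis by simp
qed

text \<open>A Gram-Schmidt step: the multiple of \<open>w\<close> is chosen to cancel the covariance
  with \<open>k\<close>, and the covariances with \<open>K\<close> stay zero.\<close>

lemma resid_insert:
  assumes "spd M" "is_resid M K a u" "is_resid M K k w" "k \<notin> K" "a \<notin> insert k K"
  shows "is_resid M (insert k K) a (u - ((M *v u) $ k / (M *v w) $ k) *s w)"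
proof -
  have "(M *v w) $ k \<noteq> 0" using resid_pos[OF assms(1,3,4)] by simp
  then show ?thesis
    using assms by (auto simp: is_resid_def matrix_vector_mult_diff_distrib matrix_vector_mult_scaleR
        vector_scalar_commute field_simps)
qed

lemma resid_exists:
  fixes M :: "real^'n^'n"
  assumes "spd M" "a \<notin> K"
  shows "\<exists>u. is_resid M K a u"
proof -
  have "finite K" by simp
  then show ?thesis using assms(2)
  proof (induction K arbitrary: a rule: finite_induct)
    case empty
    have "is_resid M {} a (axis a 1)" by (simp add: is_resid_def axis_def)
    then show ?case by blast
  next
    case (insert k K)
    then obtain u w where "is_resid M K a u" "is_resid M K k w" by blast
    then show ?case using resid_insert[OF assms(1)] insert by blast
  qed
qed

text \<open>For \<open>b\<close> outside \<open>K\<close>, symmetry compares any two residual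
  vectors of \<open>a\<close> with the same residual vector of \<open>b\<close>; for
  \<open>b\<close> in \<open>K\<close> all values are zero.\<close>

lemma ccov_eq:
  assumes "spd M" "a \<notin> K" "is_resid M K a u"
  shows "ccov M K a b = (M *v u) $ b"
proof -
  let ?u = "SOME u. is_resid M K a u"
  have u: "is_resid M K a ?u" using assms(3) by (rule someI)
  show ?thesis
  proof (cases "b \<in> K")
    case True
    then show ?thesis using u assms(3) by (simp add: ccov_def is_resid_def)
  next
    case False
    then obtain w where "is_resid M K b w" using resid_exists assms(1) by blast
    then show ?thesis
      using resid_sym[OF assms(1) u _ assms(2) False] resid_sym[OF assms(1,3) _ assms(2) False]
      by (simp add: ccov_def)
  qed
qed

lemma ccov_sym:
  assumes "spd M" "a \<notin> K" "b \<notin> K"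
  shows "ccov M K a b = ccov M K b a"
  by (metis assms ccov_eq resid_exists resid_sym)

lemma ccov_pos:
  assumes "spd M" "a \<notin> K"
  shows "ccov M K a a > 0"
  by (metis assms ccov_eq resid_exists resid_pos)

lemma ccov_in:
  assumes "spd M" "a \<notin> K" "b \<in> K"
  shows "ccov M K a b = 0"
  by (metis assms ccov_eq resid_exists is_resid_def)

text \<open>Entry \<open>b\<close> of the Gram-Schmidt step; this recursion for partial covariances
  drives the removal of a conditioned sink.\<close>

lemma ccov_insert:
  assumes "spd M" "k \<notin> K" "a \<notin> insert k K"
  shows "ccov M (insert k K) a b = ccov M K a b - ccov M K a k * ccov M K k b / ccov M K k k"
proof -
  obtain u w where u: "is_resid M K a u" and w: "is_resid M K k w"
    using resid_exists assms by (metis insertI2)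
  have a: "a \<notin> K" using assms by simp
  show ?thesis
    by (simp add: ccov_eq[OF assms(1,3) resid_insert[OF assms(1) u w assms(2,3)]]
        ccov_eq[OF assms(1) a u] ccov_eq[OF assms(1,2) w]
        matrix_vector_mult_diff_distrib vector_scalar_commute)
qed

lemma ccov_cong:
  assumes "spd M" "spd M'" "a \<notin> K"
    and eq: "\<And>x y. x \<in> insert b (insert a K) \<Longrightarrow> y \<in> insert a K \<Longrightarrow> M $ x $ y = M' $ x $ y"
  shows "ccov M K a b = ccov M' K a b"
proof -
  obtain u where u: "is_resid M K a u" using resid_exists assms by blast
  have e: "(M *v u) $ x = (M' *v u) $ x" if "x \<in> insert b (insert a K)" for x
    unfolding matrix_vector_mult_def vec_lambda_beta
    by (intro sum.cong refl) (use eq[OF that] u in \<open>auto simp: is_resid_def\<close>)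
  then have "is_resid M' K a u" using u by (auto simp: is_resid_def)
  then show ?thesis
    using ccov_eq[OF assms(1,3) u] ccov_eq[OF assms(2,3)] e by simp
qed

text \<open>A Schur complement computation: adding to row \<open>a\<close> the rows of
  \<open>K\<close> weighted by the residual vector leaves the conditional covariance times a unit
  vector.\<close>

lemma cdet_eq_ccov:
  fixes M :: "real^'n^'n"
  assumes spd: "spd M" and a: "a \<notin> K" and b: "b \<notin> K"
  shows "cdet a b K M = pdet K M * ccov M K a b"
proof -
  obtain u where u: "is_resid M K a u" using resid_exists spd a by blast
  define N :: "real^'n^'n" where "N = (\<chi> r c. if r \<in> insert a K \<and> c \<in> insert a K
      then M $ r $ (if c = a then b else c) else if r = c then 1 else 0)"
  define P :: "real^'n^'n" where "P = (\<chi> r c. if r \<in> K \<and> c \<in> K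
      then M $ r $ c else if r = c then 1 else 0)"
  define x where "x = (\<Sum>k\<in>K. u $ k *s row k N)"
  let ?s = "(M *v u) $ b"
  have Mu: "(M *v u) $ c = M $ a $ c + (\<Sum>k\<in>K. u $ k * M $ k $ c)" for c
  proof -
    have "(M *v u) $ c = (\<Sum>y\<in>UNIV. u $ y * M $ y $ c)"
      by (simp add: matrix_vector_mult_def spd_sym[OF spd, of c] mult.commute)
    also have "\<dots> = (\<Sum>y\<in>insert a K. u $ y * M $ y $ c)"
      by (rule sum.mono_neutral_right) (use u in \<open>auto simp: is_resid_def\<close>)
    also have "\<dots> = M $ a $ c + (\<Sum>k\<in>K. u $ k * M $ k $ c)"
      using a u by (simp add: is_resid_def)
    finally show ?thesis .
  qed
  have x: "x \<in> vec.span {row j N |j. j \<noteq> a}"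
    unfolding x_def
    by (intro vec.span_sum vec.span_scale vec.span_base) (use a in auto)
  \<comment> \<open>Column \<open>a\<close> of \<open>N\<close> carries column \<open>b\<close> of
    \<open>M\<close> and yields \<open>?s\<close>; in the columns of \<open>K\<close> the residual
    has covariance zero.\<close>
  have "row a N + x = ?s *s axis a 1"
  proof (subst vec_eq_iff, intro allI)
    fix c
    have "(row a N + x) $ c = N $ a $ c + (\<Sum>k\<in>K. u $ k * N $ k $ c)"
      by (simp add: x_def row_def)
    also have "\<dots> = (if c \<in> insert a K then (M *v u) $ (if c = a then b else c) else 0)"
      by (auto simp: N_def Mu intro!: sum.cong sum.neutral)
    also have "\<dots> = (?s *s axis a 1) $ c"
      using u a by (auto simp: is_resid_def axis_def)
    finally show "(row a N + x) $ c = (?s *s axis a 1) $ c" .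
  qed
  then have "det N = det (\<chi> k. if k = a then ?s *s axis a 1 else row k N)"
    using det_row_span[OF x, symmetric] by (simp only:)
  also have "\<dots> = ?s * det (\<chi> k. if k = a then axis a 1 else row k N)"
    by (rule det_row_mul)
  \<comment> \<open>With a unit vector in row \<open>a\<close>, only permutations fixing
    \<open>a\<close> contribute, and these do not read column \<open>a\<close> in the other
    rows.\<close>
  also have "det (\<chi> k. if k = a then axis a 1 else row k N) = det P"
    unfolding det_def
  proof (intro sum.cong refl, goal_cases)
    case (1 p)
    then have p: "p permutes UNIV" by simp
    let ?Q = "(\<chi> k. if k = a then axis a 1 else row k N) :: real^'n^'n"
    have "(\<Prod>i\<in>UNIV. ?Q $ i $ p i) = (\<Prod>i\<in>UNIV. P $ i $ p i)"
    proof (cases "p a = a")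
      case True
      then have "p i \<noteq> a" if "i \<noteq> a" for i using p that by (metis permutes_inj injD)
      with True show ?thesis
        by (intro prod.cong refl) (use a in \<open>auto simp: N_def P_def axis_def row_def\<close>)
    next
      case False
      then have "?Q $ a $ p a = 0" "P $ a $ p a = 0" using a by (auto simp: P_def axis_def)
      then have "(\<Prod>i\<in>UNIV. ?Q $ i $ p i) = 0" "(\<Prod>i\<in>UNIV. P $ i $ p i) = 0"
        by (meson UNIV_I finite prod_zero)+
      then show ?thesis by (simp only:)
    qed
    then show ?case by simp
  qed
  finally have "det N = ?s * det P" .
  moreover have "cdet a b K M = det N"
    by (simp add: cdet_def gdet_eq_det N_def)
  moreover have "pdet K M = det P"
    unfolding pdet_def gdet_eq_det P_def id_apply ..
  ultimately show ?thesis using ccov_eq[OF spd a u] by simp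
qed

lemma pdet_insert_eq:
  assumes "spd M" "a \<notin> K"
  shows "pdet (insert a K) M = pdet K M * ccov M K a a"
proof -
  have "(\<lambda>r. if r = a then a else r) = id" by auto
  then show ?thesis using cdet_eq_ccov[OF assms(1,2,2)] by (simp add: cdet_def pdet_def)
qed

lemma pdet_pos:
  fixes M :: "real^'n^'n"
  assumes "spd M"
  shows "pdet K M > 0"
proof -
  have "finite K" by simp
  then show ?thesis
  proof (induction K rule: finite_induct)
    case empty
    then show ?case by (simp add: pdet_def gdet_def)
  next
    case (insert k K)
    then show ?case using pdet_insert_eq[OF assms] ccov_pos[OF assms] by simp
  qed
qed

lemma omega_c_eq: "spd M \<Longrightarrow> i \<notin> A \<Longrightarrow> omega_c i A M = ccov M A i i"
  using pdet_pos[of M A] by (simp add: omega_c_def pdet_insert_eq)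

lemma lambda_c_eq_notin: "spd M \<Longrightarrow> i \<notin> A \<Longrightarrow> j \<notin> A \<Longrightarrow> lambda_c i j A M = ccov M A i j"
  using pdet_pos[of M A] by (simp add: lambda_c_def cdet_eq_ccov)

lemma lambda_c_eq_in:
  assumes "spd M" "i \<in> A" "j \<notin> A"
  shows "lambda_c i j A M = ccov M (A - {i}) i j / ccov M (A - {i}) i i"
proof -
  have "pdet A M = pdet (A - {i}) M * ccov M (A - {i}) i i"
    using pdet_insert_eq[OF assms(1), of i "A - {i}"] assms(2) by (simp add: insert_absorb)
  then show ?thesis
    using pdet_pos[OF assms(1), of "A - {i}"] assms by (simp add: lambda_c_def cdet_eq_ccov)
qed

text \<open>The cases \<open>i \<in> A\<close> and \<open>i \<notin> A\<close> differ only by a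
  positive factor, so vanishing can be studied on the conditional covariance.\<close>

lemma lambda_c_zero_iff:
  assumes "spd M" "j \<notin> A" "i \<noteq> j"
  shows "lambda_c i j A M = 0 \<longleftrightarrow> ccov M (A - {i}) i j = 0"
proof (cases "i \<in> A")
  case True
  then show ?thesis using ccov_pos[OF assms(1), of i "A - {i}"] assms by (simp add: lambda_c_eq_in)
next
  case False
  then show ?thesis using assms by (simp add: lambda_c_eq_notin)
qed

section \<open>Covariance matrices of linear structural equations\<close>

definition supported :: "('n \<times> 'n) set \<Rightarrow> real^'n^'n \<Rightarrow> bool" where
  "supported E \<Lambda> \<longleftrightarrow> (\<forall>x y. (x, y) \<notin> E \<longrightarrow> \<Lambda> $ x $ y = 0)"

text \<open>Entry \<open>(x, y)\<close> is the total effect of \<open>x\<close> on \<open>y\<close>: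
  for coefficients supported on a DAG, the sum over directed paths of the products of edge
  coefficients.\<close>

abbreviation effects :: "real^'n^'n \<Rightarrow> real^'n^'n" where
  "effects \<Lambda> \<equiv> matrix_inv (mat 1 - \<Lambda>)"

lemma params_iff: "params E \<omega> \<Lambda> \<longleftrightarrow> (\<forall>i. \<omega> i > 0) \<and> supported E \<Lambda>"
  by (simp add: params_def supported_def)

lemma supported_mono: "supported E \<Lambda> \<Longrightarrow> E \<subseteq> F \<Longrightarrow> supported F \<Lambda>"
  by (auto simp: supported_def)

lemma wf_dag: "acyclic (E :: ('n::finite \<times> 'n) set) \<Longrightarrow> wf E"
  by (simp add: finite_acyclic_wf)

text \<open>A kernel vector of the transpose satisfies a homogeneous recursion over parents and
  vanishes by induction along the edges.\<close>

lemma invertible_dag: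
  fixes E :: "('n::finite \<times> 'n) set"
  assumes "acyclic E" "supported E \<Lambda>"
  shows "invertible (mat 1 - \<Lambda>)"
proof -
  have "x = 0" if x: "transpose (mat 1 - \<Lambda>) *v x = 0" for x
  proof -
    have eq: "x $ y = (\<Sum>p\<in>UNIV. x $ p * \<Lambda> $ p $ y)" for y
    proof -
      have "0 = (transpose (mat 1 - \<Lambda>) *v x) $ y" using x by simp
      also have "\<dots> = (\<Sum>p\<in>UNIV. (if p = y then x $ p else 0) - x $ p * \<Lambda> $ p $ y)"
        unfolding matrix_vector_mult_def transpose_def mat_def vec_lambda_beta
        by (intro sum.cong refl) (auto simp: algebra_simps)
      also have "\<dots> = x $ y - (\<Sum>p\<in>UNIV. x $ p * \<Lambda> $ p $ y)"
        by (simp add: sum_subtractf)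
      finally show ?thesis by simp
    qed
    have "x $ y = 0" for y
    proof (induction y rule: wf_induct_rule[OF wf_dag[OF assms(1)]])
      case (1 y)
      then have "x $ p * \<Lambda> $ p $ y = 0" for p
        using assms(2) by (cases "(p, y) \<in> E") (auto simp: supported_def)
      then have "(\<Sum>p\<in>UNIV. x $ p * \<Lambda> $ p $ y) = 0" by (intro sum.neutral) blast
      then show ?case using eq[of y] by simp
    qed
    then show ?thesis by (simp add: vec_eq_iff)
  qed
  then have "invertible (transpose (mat 1 - \<Lambda>))"
    using matrix_left_invertible_ker invertible_left_inverse by blast
  then show ?thesis using transpose_invertible by fastforce
qed

lemma effects_inverse:
  fixes E :: "('n::finite \<times> 'n) set"
  assumes "acyclic E" "supported E \<Lambda>"
  shows "effects \<Lambda> ** (mat 1 - \<Lambda>) = mat 1" "(mat 1 - \<Lambda>) ** effects \<Lambda> = mat 1"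
  using someI_ex[OF invertible_dag[OF assms, unfolded invertible_def]]
  by (simp_all add: matrix_inv_def)

text \<open>Splits off the last edge of a directed path, which allows induction along the
  DAG.\<close>

lemma effects_rec:
  fixes E :: "('n::finite \<times> 'n) set"
  assumes "acyclic E" "supported E \<Lambda>"
  shows "effects \<Lambda> $ x $ y = (if x = y then 1 else 0) + (\<Sum>p\<in>UNIV. effects \<Lambda> $ x $ p * \<Lambda> $ p $ y)"
proof -
  have "(effects \<Lambda> ** (mat 1 - \<Lambda>)) $ x $ y = (mat 1 :: real^'n^'n) $ x $ y"
    using effects_inverse(1)[OF assms] by simp
  moreover have "(effects \<Lambda> ** (mat 1 - \<Lambda>)) $ x $ y =
      effects \<Lambda> $ x $ y - (\<Sum>p\<in>UNIV. effects \<Lambda> $ x $ p * \<Lambda> $ p $ y)"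
  proof -
    have "(effects \<Lambda> ** (mat 1 - \<Lambda>)) $ x $ y =
       (\<Sum>p\<in>UNIV. (if p = y then effects \<Lambda> $ x $ p else 0) - effects \<Lambda> $ x $ p * \<Lambda> $ p $ y)"
      unfolding matrix_matrix_mult_def mat_def vec_lambda_beta
      by (intro sum.cong refl) (auto simp: algebra_simps)
    then show ?thesis by (simp add: sum_subtractf)
  qed
  ultimately show ?thesis by (simp add: mat_def split: if_splits)
qed

lemma effects_nonzero:
  fixes E :: "('n::finite \<times> 'n) set"
  assumes "acyclic E" "supported E \<Lambda>" "effects \<Lambda> $ x $ y \<noteq> 0"
  shows "(x, y) \<in> E\<^sup>*"
  using assms(3)
proof (induction y rule: wf_induct_rule[OF wf_dag[OF assms(1)]])
  case (1 y)
  show ?case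
  proof (cases "x = y")
    case False
    then have "(\<Sum>p\<in>UNIV. effects \<Lambda> $ x $ p * \<Lambda> $ p $ y) \<noteq> 0"
      using effects_rec[OF assms(1,2), of x y] 1(2) by simp
    then obtain p where "effects \<Lambda> $ x $ p \<noteq> 0" "\<Lambda> $ p $ y \<noteq> 0"
      by (metis (no_types, lifting) mult_zero_left mult_zero_right sum.neutral)
    then show ?thesis
      using 1(1) assms(2) unfolding supported_def by (meson rtrancl.rtrancl_into_rtrancl)
  qed simp
qed

lemma effects_diag:
  fixes E :: "('n::finite \<times> 'n) set"
  assumes "acyclic E" "supported E \<Lambda>"
  shows "effects \<Lambda> $ x $ x = 1"
proof -
  have "effects \<Lambda> $ x $ p * \<Lambda> $ p $ x = 0" for p
  proof (rule ccontr)
    assume "\<not> ?thesis"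
    then have "(x, p) \<in> E\<^sup>*" "(p, x) \<in> E"
      using effects_nonzero[OF assms] assms(2) by (auto simp: supported_def)
    then show False using assms(1) by (meson acyclic_def rtrancl_into_trancl1)
  qed
  then have "(\<Sum>p\<in>UNIV. effects \<Lambda> $ x $ p * \<Lambda> $ p $ x) = 0" by (intro sum.neutral) blast
  then show ?thesis using effects_rec[OF assms, of x x] by simp
qed

text \<open>\<open>W\<close> is closed under parents, so the recursion for a column in
  \<open>W\<close> never reads a coefficient of a column outside \<open>W\<close>.\<close>

lemma effects_cong:
  fixes E :: "('n::finite \<times> 'n) set"
  assumes "acyclic E" "supported E \<Lambda>" "supported E \<Lambda>'"
    and W: "\<And>p y. (p, y) \<in> E \<Longrightarrow> y \<in> W \<Longrightarrow> p \<in> W"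
    and eq: "\<And>p y. y \<in> W \<Longrightarrow> \<Lambda> $ p $ y = \<Lambda>' $ p $ y"
    and "y \<in> W"
  shows "effects \<Lambda> $ x $ y = effects \<Lambda>' $ x $ y"
  using assms(6)
proof (induction y rule: wf_induct_rule[OF wf_dag[OF assms(1)]])
  case (1 y)
  have "effects \<Lambda> $ x $ p * \<Lambda> $ p $ y = effects \<Lambda>' $ x $ p * \<Lambda>' $ p $ y" for p
  proof (cases "(p, y) \<in> E")
    case True
    then show ?thesis using 1 W eq by metis
  next
    case False
    then show ?thesis using assms(2,3) by (simp add: supported_def)
  qed
  then show ?case using effects_rec[OF assms(1,2), of x y] effects_rec[OF assms(1,3), of x y] by simp
qed

lemma phiG_entry:
  "phiG \<omega> \<Lambda> $ x $ y = (\<Sum>s\<in>UNIV. \<omega> s * effects \<Lambda> $ s $ x * effects \<Lambda> $ s $ y)"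
proof -
  have "(\<Sum>k\<in>UNIV. transpose (effects \<Lambda>) $ x $ k * diagm \<omega> $ k $ s) = effects \<Lambda> $ s $ x * \<omega> s" for s
  proof -
    have "(\<Sum>k\<in>UNIV. transpose (effects \<Lambda>) $ x $ k * diagm \<omega> $ k $ s)
        = (\<Sum>k\<in>UNIV. if k = s then effects \<Lambda> $ s $ x * \<omega> s else 0)"
      by (intro sum.cong refl) (auto simp: transpose_def diagm_def)
    then show ?thesis by simp
  qed
  then show ?thesis
    by (simp add: phiG_def matrix_matrix_mult_def mult_ac)
qed

lemma phiG_sym: "phiG \<omega> \<Lambda> $ x $ y = phiG \<omega> \<Lambda> $ y $ x"
  by (simp add: phiG_entry mult_ac)

text \<open>The structural equation of \<open>y\<close>, paired with the variable of
  \<open>x\<close>; the last term is the covariance of that variable with the error of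
  \<open>y\<close>.\<close>

lemma phiG_rec:
  fixes E :: "('n::finite \<times> 'n) set"
  assumes "acyclic E" "supported E \<Lambda>"
  shows "phiG \<omega> \<Lambda> $ x $ y = (\<Sum>p\<in>UNIV. phiG \<omega> \<Lambda> $ x $ p * \<Lambda> $ p $ y) + \<omega> y * effects \<Lambda> $ y $ x"
proof -
  let ?B = "effects \<Lambda>"
  have "phiG \<omega> \<Lambda> $ x $ y = (\<Sum>s\<in>UNIV. \<omega> s * ?B $ s $ x * ((if s = y then 1 else 0)
      + (\<Sum>p\<in>UNIV. ?B $ s $ p * \<Lambda> $ p $ y)))"
    unfolding phiG_entry using effects_rec[OF assms, of _ y] by simp
  also have "\<dots> = (\<Sum>s\<in>UNIV. if s = y then \<omega> s * ?B $ s $ x else 0)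
      + (\<Sum>s\<in>UNIV. \<Sum>p\<in>UNIV. \<omega> s * ?B $ s $ x * ?B $ s $ p * \<Lambda> $ p $ y)"
    unfolding sum.distrib[symmetric]
    by (intro sum.cong refl) (auto simp: algebra_simps sum_distrib_left)
  also have "(\<Sum>s\<in>UNIV. if s = y then \<omega> s * ?B $ s $ x else 0) = \<omega> y * ?B $ y $ x" by simp
  also have "(\<Sum>s\<in>UNIV. \<Sum>p\<in>UNIV. \<omega> s * ?B $ s $ x * ?B $ s $ p * \<Lambda> $ p $ y)
      = (\<Sum>p\<in>UNIV. phiG \<omega> \<Lambda> $ x $ p * \<Lambda> $ p $ y)"
    unfolding phiG_entry sum_distrib_right by (rule sum.swap)
  finally show ?thesis by simp
qed

text \<open>The substitution \<open>z = effects \<Lambda> *v x\<close> turns the quadratic form into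
  a sum of squares with the positive weights \<omega>.\<close>

lemma spd_phiG:
  fixes E :: "('n::finite \<times> 'n) set"
  assumes "acyclic E" "params E \<omega> \<Lambda>"
  shows "spd (phiG \<omega> \<Lambda>)"
proof -
  have \<omega>: "\<And>s. \<omega> s > 0" and sup: "supported E \<Lambda>" using assms(2) by (auto simp: params_iff)
  have "x \<bullet> (phiG \<omega> \<Lambda> *v x) > 0" if "x \<noteq> 0" for x
  proof -
    define z where "z = effects \<Lambda> *v x"
    have "x = (mat 1 - \<Lambda>) *v z"
      unfolding z_def matrix_vector_mul_assoc effects_inverse(2)[OF assms(1) sup] by simp
    then have "z \<noteq> 0" using that by auto
    then obtain s where s: "z $ s \<noteq> 0" by (auto simp: vec_eq_iff)
    have "phiG \<omega> \<Lambda> *v x = (diagm \<omega> *v z) v* effects \<Lambda>"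
      unfolding z_def phiG_def transpose_matrix_vector[symmetric]
      by (simp only: matrix_vector_mul_assoc matrix_mul_assoc)
    then have "x \<bullet> (phiG \<omega> \<Lambda> *v x) = z \<bullet> (diagm \<omega> *v z)"
      by (metis dot_lmul_matrix inner_commute z_def)
    also have "diagm \<omega> *v z = (\<chi> s. \<omega> s * z $ s)"
    proof (subst vec_eq_iff, intro allI)
      fix s
      have "(diagm \<omega> *v z) $ s = (\<Sum>t\<in>UNIV. if t = s then \<omega> s * z $ s else 0)"
        unfolding matrix_vector_mult_def diagm_def vec_lambda_beta
        by (intro sum.cong refl) auto
      then show "(diagm \<omega> *v z) $ s = (\<chi> s. \<omega> s * z $ s) $ s" by simp
    qed
    also have "z \<bullet> (\<chi> s. \<omega> s * z $ s) = (\<Sum>s\<in>UNIV. \<omega> s * (z $ s)\<^sup>2)"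
      by (simp add: inner_vec_def power2_eq_square mult_ac)
    also have "\<dots> > 0"
      by (rule sum_pos2[of _ s]) (use s \<omega> in \<open>auto simp: less_imp_le\<close>)
    finally show ?thesis .
  qed
  then show ?thesis using phiG_sym by (auto simp: spd_def)
qed

lemma phiG_cong:
  fixes E :: "('n::finite \<times> 'n) set"
  assumes "acyclic E" "supported E \<Lambda>" "supported E \<Lambda>'"
    and "\<And>p y. (p, y) \<in> E \<Longrightarrow> y \<in> W \<Longrightarrow> p \<in> W"
    and "\<And>p y. y \<in> W \<Longrightarrow> \<Lambda> $ p $ y = \<Lambda>' $ p $ y"
    and "x \<in> W" "y \<in> W"
  shows "phiG \<omega> \<Lambda> $ x $ y = phiG \<omega> \<Lambda>' $ x $ y"
  unfolding phiG_entry using effects_cong[OF assms(1-5)] assms(6,7) by simp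

lemma phiG_nondesc:
  fixes E :: "('n::finite \<times> 'n) set"
  assumes "acyclic E" "supported E \<Lambda>" "x \<notin> deb E y"
  shows "phiG \<omega> \<Lambda> $ x $ y = (\<Sum>p\<in>UNIV. phiG \<omega> \<Lambda> $ x $ p * \<Lambda> $ p $ y)"
proof -
  have "effects \<Lambda> $ y $ x = 0"
    using effects_nonzero[OF assms(1,2), of y x] assms(3)
    by (auto simp: deb_def de_def rtrancl_eq_or_trancl)
  then show ?thesis using phiG_rec[OF assms(1,2), of \<omega> x y] by simp
qed

text \<open>The error of \<open>v\<close> is uncorrelated with the nondescendants of
  \<open>v\<close>, hence with the residual of \<open>a\<close> given \<open>K\<close>, so the
  structural equation of \<open>v\<close> passes to conditional covariances.\<close>

lemma ccov_nondesc:
  fixes E :: "('n::finite \<times> 'n) set"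
  assumes "acyclic E" "params E \<omega> \<Lambda>" "a \<notin> K" "insert a K \<inter> deb E v = {}"
  shows "ccov (phiG \<omega> \<Lambda>) K a v = (\<Sum>p\<in>UNIV. \<Lambda> $ p $ v * ccov (phiG \<omega> \<Lambda>) K a p)"
proof -
  let ?S = "phiG \<omega> \<Lambda>"
  have sup: "supported E \<Lambda>" using assms(2) by (simp add: params_iff)
  have spd: "spd ?S" using spd_phiG assms by blast
  obtain u where u: "is_resid ?S K a u" using resid_exists spd assms by blast
  have "(?S *v u) $ v = (\<Sum>x\<in>UNIV. \<Sum>p\<in>UNIV. \<Lambda> $ p $ v * (?S $ p $ x * u $ x))"
    unfolding matrix_vector_mult_def vec_lambda_beta
  proof (intro sum.cong refl)
    fix x
    show "?S $ v $ x * u $ x = (\<Sum>p\<in>UNIV. \<Lambda> $ p $ v * (?S $ p $ x * u $ x))"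
    proof (cases "u $ x = 0")
      case False
      then have "x \<notin> deb E v" using u assms(4) by (auto simp: is_resid_def)
      then have "?S $ v $ x = (\<Sum>p\<in>UNIV. ?S $ p $ x * \<Lambda> $ p $ v)"
        using phiG_nondesc[OF assms(1) sup, of x v \<omega>] phiG_sym[of \<omega> \<Lambda> x] by simp
      then show ?thesis by (simp add: sum_distrib_left mult_ac)
    qed simp
  qed
  also have "\<dots> = (\<Sum>p\<in>UNIV. \<Lambda> $ p $ v * (?S *v u) $ p)"
    unfolding matrix_vector_mult_def vec_lambda_beta sum_distrib_left by (rule sum.swap)
  finally show ?thesis using ccov_eq[OF spd assms(3) u] by simp
qed

section \<open>d-connection\<close>

definition anc :: "('n \<times> 'n) set \<Rightarrow> 'n set \<Rightarrow> 'n set" where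
  "anc E K = {x. \<exists>k\<in>K. (x, k) \<in> E\<^sup>*}"

text \<open>The Bayes ball: \<open>x\<close> is reached from \<open>a\<close> along a walk that is open given \<open>K\<close>, and \<open>h\<close> tells
  whether the last edge of the walk points into \<open>x\<close>.\<close>
inductive bball :: "('n \<times> 'n) set \<Rightarrow> 'n set \<Rightarrow> 'n \<Rightarrow> bool \<Rightarrow> 'n \<Rightarrow> bool"
  for E :: "('n \<times> 'n) set" and K :: "'n set" and a :: 'n where
  start: "a \<notin> K \<Longrightarrow> bball E K a False a"
| down: "bball E K a h x \<Longrightarrow> x \<notin> K \<Longrightarrow> (x, y) \<in> E \<Longrightarrow> bball E K a True y"
| up: "bball E K a False x \<Longrightarrow> (y, x) \<in> E \<Longrightarrow> y \<notin> K \<Longrightarrow> bball E K a False y"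
| collide: "bball E K a True x \<Longrightarrow> x \<in> anc E K \<Longrightarrow> (y, x) \<in> E \<Longrightarrow> y \<notin> K \<Longrightarrow> bball E K a False y"

definition dconn :: "('n \<times> 'n) set \<Rightarrow> 'n set \<Rightarrow> 'n \<Rightarrow> 'n \<Rightarrow> bool" where
  "dconn E K a b \<longleftrightarrow> (\<exists>h. bball E K a h b)"

lemma bball_False_notin: "bball E K a h x \<Longrightarrow> \<not> h \<Longrightarrow> x \<notin> K"
  by (induction rule: bball.induct) auto

lemma anc_step: "(x, y) \<in> E \<Longrightarrow> y \<in> anc E K \<Longrightarrow> x \<in> anc E K"
  unfolding anc_def by (auto intro: converse_rtrancl_into_rtrancl)

lemma subset_anc: "x \<in> K \<Longrightarrow> x \<in> anc E K"
  unfolding anc_def by auto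

text \<open>The flag \<open>False\<close> at \<open>q\<close> is the state in which a ball starts,
  so any open walk from \<open>q\<close> may be appended.\<close>

lemma bball_trans: "bball E K q h x \<Longrightarrow> bball E K a False q \<Longrightarrow> bball E K a h x"
  by (induction rule: bball.induct) (auto intro: bball.intros)

lemma bball_refl: "a \<notin> K \<Longrightarrow> dconn E K a a"
  unfolding dconn_def by (auto intro: bball.start)

section \<open>Open walks and the deletion of a sink\<close>

text \<open>Vertices form a fixed type, so a sink is removed by isolating it: its incoming edges are
  deleted, and a sink has no others.\<close>

definition cut :: "'n \<Rightarrow> ('n \<times> 'n) set \<Rightarrow> ('n \<times> 'n) set" where
  "cut v E = {(x, y). (x, y) \<in> E \<and> y \<noteq> v}"

lemma cut_subset: "cut v E \<subseteq> E"
  by (auto simp: cut_def)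

lemma sink_trancl:
  assumes "\<And>y. (v, y) \<notin> E" "(x, y) \<in> E\<^sup>*" "y \<noteq> v"
  shows "(x, y) \<in> (cut v E)\<^sup>*"
  using assms(2,3)
proof (induction rule: rtrancl_induct)
  case (step y z)
  then have "y \<noteq> v" using assms(1) by auto
  with step show ?case by (auto simp: cut_def intro: rtrancl_into_rtrancl)
qed simp

lemma cut_anc: "anc (cut v E) K \<subseteq> anc E K"
  unfolding anc_def using rtrancl_mono[OF cut_subset[of v E]] by blast

lemma sink_anc:
  assumes "\<And>y. (v, y) \<notin> E" "v \<notin> K"
  shows "anc (cut v E) K = anc E K"
  using cut_anc[of v E K] sink_trancl[OF assms(1)] assms(2) unfolding anc_def by blast

text \<open>A vertex that is an ancestor of the conditioning set only because of \<open>v\<close>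
  reaches \<open>v\<close> through a parent of \<open>v\<close>.\<close>

lemma sink_anc_insert:
  assumes "\<And>y. (v, y) \<notin> E" "x \<in> anc E (insert v K)" "x \<noteq> v" "x \<notin> anc (cut v E) K"
  obtains p where "(p, v) \<in> E" "(x, p) \<in> (cut v E)\<^sup>*"
proof -
  obtain k where k: "k \<in> insert v K" "(x, k) \<in> E\<^sup>*" using assms(2) unfolding anc_def by blast
  have "k = v"
  proof (rule ccontr)
    assume "k \<noteq> v"
    then have "(x, k) \<in> (cut v E)\<^sup>*" using sink_trancl[OF assms(1) k(2)] by blast
    then show False using assms(4) k(1) \<open>k \<noteq> v\<close> unfolding anc_def by blast
  qed
  then have "(x, v) \<in> E\<^sup>*" using k by simp
  then obtain p where p: "(x, p) \<in> E\<^sup>*" "(p, v) \<in> E" using assms(3) by (meson rtranclE)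
  moreover have "p \<noteq> v" using p assms(1) by auto
  ultimately show ?thesis using sink_trancl[OF assms(1)] that by blast
qed

lemma bball_cut_avoid: "bball (cut v E) K a h x \<Longrightarrow> (\<And>y. (v, y) \<notin> E) \<Longrightarrow> a \<noteq> v \<Longrightarrow> x \<noteq> v"
  by (induction rule: bball.induct) (auto simp: cut_def)

text \<open>A walk in the cut graph avoids \<open>v\<close>, so conditioning on \<open>v\<close>
  cannot close it; restoring edges only enlarges the set of ancestors.\<close>

lemma bball_cut_imp:
  assumes "bball (cut v E) K a h x" "\<And>y. (v, y) \<notin> E" "a \<noteq> v"
  shows "bball E K a h x" "bball E (insert v K) a h x"
proof -
  have anc: "anc (cut v E) K \<subseteq> anc E K \<inter> anc E (insert v K)"
    using rtrancl_mono[OF cut_subset[of v E]] unfolding anc_def by blast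
  have sub: "(x, y) \<in> cut v E \<Longrightarrow> (x, y) \<in> E" for x y by (auto simp: cut_def)
  show "bball E K a h x" using assms(1)
  proof (induction rule: bball.induct)
    case (collide x y)
    then show ?case using anc sub by (blast intro: bball.collide)
  qed (auto intro: bball.intros sub)
  show "bball E (insert v K) a h x" using assms(1)
  proof (induction rule: bball.induct)
    case start
    then show ?case using assms(3) by (auto intro: bball.start)
  next
    case (down h x y)
    then have "x \<notin> insert v K" using bball_cut_avoid[OF _ assms(2,3)] by auto
    then show ?case using down sub by (blast intro: bball.down)
  next
    case (up x y)
    then have "y \<notin> insert v K" using assms(2) sub by blast
    then show ?case using up sub by (blast intro: bball.up)
  next
    case (collide x y)
    then have "y \<notin> insert v K" using assms(2) sub by blast
    then show ?case using collide anc sub by (blast intro: bball.collide)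
  qed
qed

text \<open>An unconditioned sink is a dead end: it has no child to move to and is no ancestor of
  \<open>K\<close>, hence no open collider.\<close>

lemma bball_sink_imp_cut:
  assumes "bball E K a h x" "\<And>y. (v, y) \<notin> E" "a \<noteq> v" "v \<notin> K"
  shows "x = v \<and> h \<or> x \<noteq> v \<and> bball (cut v E) K a h x"
  using assms(1)
proof (induction rule: bball.induct)
  case start
  then show ?case using assms(3) by (auto intro: bball.start)
next
  case (down h x y)
  then have "x \<noteq> v" using assms(2) by blast
  then show ?case using down by (auto simp: cut_def intro: bball.down)
next
  case (up x y)
  then show ?case using assms(2) by (auto simp: cut_def intro: bball.up)
next
  case (collide x y)
  have "v \<notin> anc E K" using assms(2,4) unfolding anc_def by (auto elim: converse_rtranclE)
  then have "x \<noteq> v" using collide by auto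
  then show ?case
    using collide assms(2) sink_anc[OF assms(2,4)] by (auto simp: cut_def intro: bball.collide)
qed

lemma dconn_sink_other:
  assumes "\<And>y. (v, y) \<notin> E" "v \<notin> K" "v \<noteq> a" "v \<noteq> b"
  shows "dconn E K a b \<longleftrightarrow> dconn (cut v E) K a b"
  unfolding dconn_def
  using bball_sink_imp_cut[OF _ assms(1) assms(3)[symmetric] assms(2)]
    bball_cut_imp(1)[OF _ assms(1) assms(3)[symmetric]] assms(4) by blast

lemma dconn_sink_right:
  assumes "\<And>y. (b, y) \<notin> E" "b \<notin> K" "b \<noteq> a"
  shows "dconn E K a b \<longleftrightarrow> (\<exists>p. (p, b) \<in> E \<and> p \<notin> K \<and> dconn (cut b E) K a p)"
proof
  assume "dconn E K a b"
  then obtain h where "bball E K a h b" by (auto simp: dconn_def)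
  then show "\<exists>p. (p, b) \<in> E \<and> p \<notin> K \<and> dconn (cut b E) K a p"
  proof cases
    case (down h x)
    then have "x \<noteq> b" using assms(1) by blast
    then have "bball (cut b E) K a h x" using bball_sink_imp_cut[OF down(2) assms(1)] assms by blast
    then show ?thesis using down unfolding dconn_def by blast
  qed (use assms in auto)
next
  assume "\<exists>p. (p, b) \<in> E \<and> p \<notin> K \<and> dconn (cut b E) K a p"
  then obtain p h where "(p, b) \<in> E" "p \<notin> K" "bball (cut b E) K a h p" by (auto simp: dconn_def)
  then show "dconn E K a b"
    using bball_cut_imp(1)[OF _ assms(1)] assms(3) unfolding dconn_def by (metis bball.down)
qed

text \<open>The mirror image of \<open>dconn_sink_right\<close>; it takes an induction because
  \<open>bball\<close> grows at the other end.\<close>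

lemma dconn_sink_left:
  assumes sink: "\<And>y. (a, y) \<notin> E" and "a \<notin> K" "b \<noteq> a"
  shows "dconn E K a b \<longleftrightarrow> (\<exists>p. (p, a) \<in> E \<and> p \<notin> K \<and> dconn (cut a E) K p b)"
proof
  assume "dconn E K a b"
  then obtain h where "bball E K a h b" by (auto simp: dconn_def)
  \<comment> \<open>The disjunct \<open>b = a\<close> covers a ball at \<open>a\<close>, initially
    or after a return; from there only \<open>up\<close> to a parent can continue.\<close>
  then have "b = a \<or> (\<exists>p. (p, a) \<in> E \<and> p \<notin> K \<and> bball (cut a E) K p h b)"
  proof (induction rule: bball.induct)
    case (down h x y)
    then have "x \<noteq> a" using sink by blast
    then show ?case using down by (auto simp: cut_def intro: bball.down)
  next
    case (up x y)
    then show ?case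
      by (cases "x = a") (auto simp: cut_def intro: bball.up bball.start)
  next
    case (collide x y)
    have "a \<notin> anc E K" using sink assms(2) unfolding anc_def by (auto elim: converse_rtranclE)
    then have "x \<noteq> a" using collide by auto
    then show ?case
      using collide sink_anc[OF sink assms(2)] by (auto simp: cut_def intro: bball.collide)
  qed simp
  then show "\<exists>p. (p, a) \<in> E \<and> p \<notin> K \<and> dconn (cut a E) K p b"
    using assms(3) unfolding dconn_def by blast
next
  assume "\<exists>p. (p, a) \<in> E \<and> p \<notin> K \<and> dconn (cut a E) K p b"
  then obtain p h where p: "(p, a) \<in> E" "p \<notin> K" and b: "bball (cut a E) K p h b"
    by (auto simp: dconn_def)
  have "p \<noteq> a" using p sink by blast
  then have "bball E K p h b" using bball_cut_imp(1)[OF b sink] by blast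
  moreover have "bball E K a False p" using p assms(2) by (auto intro: bball.start bball.up)
  ultimately show "dconn E K a b" unfolding dconn_def by (metis bball_trans)
qed

text \<open>Below a non-ancestor of \<open>K\<close> there are only non-ancestors of
  \<open>K\<close>, so no conditioned vertex stops the descending ball.\<close>

lemma bball_down_path:
  assumes "(x, p) \<in> E\<^sup>*" "bball E K a h x" "x \<notin> anc E K"
  shows "p \<notin> K \<and> (\<exists>h. bball E K a h p)"
proof -
  have "p \<notin> anc E K \<and> (\<exists>h. bball E K a h p)"
    using assms(1)
  proof (induction rule: rtrancl_induct)
    case base
    then show ?case using assms(2,3) by blast
  next
    case (step y z)
    then have "(x, z) \<in> E\<^sup>*" by auto
    then have "z \<notin> anc E K" using assms(3) unfolding anc_def by (auto dest: rtrancl_trans)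
    moreover have "y \<notin> K" using step.IH subset_anc[of y K E] by auto
    ultimately show ?case using step bball.down[of E K a _ y z] by auto
  qed
  then show ?thesis using subset_anc[of p K E] by auto
qed

text \<open>The same kind of path, climbed from its lower end.\<close>

lemma bball_up_path:
  assumes "(x, p) \<in> E\<^sup>*" "x \<notin> anc E K"
  shows "bball E K p False x"
  using assms
proof (induction rule: converse_rtrancl_induct)
  case base
  then show ?case using subset_anc by (metis bball.start)
next
  case (step y z)
  have "y \<notin> K" using step.prems subset_anc by metis
  moreover have "z \<notin> anc E K" using step anc_step by metis
  ultimately show ?case using step by (auto intro: bball.up)
qed

text \<open>A conditioned sink can be passed only as a collider, between two of its parents. It also
  opens colliders that are its ancestors; these are traded for a detour through a parent of
  \<open>v\<close>.\<close>

lemma dconn_sink_in: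
  assumes sink: "\<And>y. (v, y) \<notin> E" and v: "v \<notin> K" and a: "a \<notin> insert v K" and b: "b \<notin> insert v K"
  shows "dconn E (insert v K) a b \<longleftrightarrow> dconn (cut v E) K a b \<or>
    (\<exists>p q. (p, v) \<in> E \<and> p \<notin> K \<and> dconn (cut v E) K a p \<and> (q, v) \<in> E \<and> q \<notin> K \<and> dconn (cut v E) K q b)"
proof
  let ?C = "\<exists>p. (p, v) \<in> E \<and> p \<notin> K \<and> dconn (cut v E) K a p"
  assume "dconn E (insert v K) a b"
  then obtain h where "bball E (insert v K) a h b" by (auto simp: dconn_def)
  \<comment> \<open>Either the walk needs no help from \<open>v\<close>, or its last use of
    \<open>v\<close> counts as a restart at a parent \<open>q\<close>; \<open>?C\<close> remembers
    that some parent was reached from \<open>a\<close>.\<close>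
  then have "(b = v \<and> h \<and> ?C) \<or> b \<noteq> v \<and>
      (bball (cut v E) K a h b \<or> ?C \<and> (\<exists>q. (q, v) \<in> E \<and> q \<notin> K \<and> bball (cut v E) K q h b))"
  proof (induction rule: bball.induct)
    case start
    then show ?case by (auto intro: bball.start)
  next
    case (down h x y)
    show ?case
    proof (cases "y = v")
      case True
      then show ?thesis using down by (auto simp: dconn_def)
    next
      case False
      then show ?thesis using down by (auto simp: cut_def intro: bball.down)
    qed
  next
    case (up x y)
    then show ?case by (auto simp: cut_def intro: bball.up)
  next
    case (collide x y)
    have y: "y \<noteq> v" using sink collide by blast
    show ?case
    proof (cases "x = v")
      case True
      then show ?thesis using collide y by (auto intro: bball.start)
    next
      case xv: False
      show ?thesis
      proof (cases "x \<in> anc (cut v E) K")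
        case True
        then show ?thesis using collide xv y by (auto simp: cut_def intro: bball.collide)
      next
        case False
        \<comment> \<open>The collider \<open>x\<close> is open only thanks to \<open>v\<close>. The
          detour from \<open>x\<close> down to \<open>p\<close>, to \<open>v\<close> and back up to
          \<open>x\<close> uses \<open>p\<close> as both parents.\<close>
        obtain p where p: "(p, v) \<in> E" "(x, p) \<in> (cut v E)\<^sup>*"
          using sink_anc_insert[OF sink collide(2) xv False] by blast
        have "?C"
          using collide xv bball_down_path[OF p(2) _ False, of a] p(1) unfolding dconn_def by blast
        moreover have "p \<notin> K"
          using p(2) False unfolding anc_def by blast
        moreover have "bball (cut v E) K p False y"
          using bball_up_path[OF p(2) False] collide xv by (auto simp: cut_def intro: bball.up)
        ultimately show ?thesis using p y by blast
      qed
    qed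
  qed
  then show "dconn (cut v E) K a b \<or>
    (\<exists>p q. (p, v) \<in> E \<and> p \<notin> K \<and> dconn (cut v E) K a p \<and> (q, v) \<in> E \<and> q \<notin> K \<and> dconn (cut v E) K q b)"
    using b unfolding dconn_def by blast
next
  have av: "a \<noteq> v" using a by auto
  assume "dconn (cut v E) K a b \<or>
    (\<exists>p q. (p, v) \<in> E \<and> p \<notin> K \<and> dconn (cut v E) K a p \<and> (q, v) \<in> E \<and> q \<notin> K \<and> dconn (cut v E) K q b)"
  then show "dconn E (insert v K) a b"
  proof
    assume "dconn (cut v E) K a b"
    then show ?thesis using bball_cut_imp(2)[OF _ sink av] unfolding dconn_def by blast
  next
    assume "\<exists>p q. (p, v) \<in> E \<and> p \<notin> K \<and> dconn (cut v E) K a p \<and> (q, v) \<in> E \<and> q \<notin> K \<and> dconn (cut v E) K q b"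
    then obtain p q h h' where p: "(p, v) \<in> E" "p \<notin> K" "bball (cut v E) K a h p"
      and q: "(q, v) \<in> E" "q \<notin> K" "bball (cut v E) K q h' b" by (auto simp: dconn_def)
    have "p \<noteq> v" "q \<noteq> v" using p q sink by blast+
    have "bball E (insert v K) a True v"
      using bball_cut_imp(2)[OF p(3) sink av] p \<open>p \<noteq> v\<close> by (auto intro: bball.down)
    then have "bball E (insert v K) a False q"
      using q \<open>q \<noteq> v\<close> subset_anc[of v "insert v K"] by (auto intro: bball.collide)
    moreover have "bball E (insert v K) q h' b"
      using bball_cut_imp(2)[OF q(3) sink \<open>q \<noteq> v\<close>] .
    ultimately show ?thesis unfolding dconn_def by (metis bball_trans)
  qed
qed

section \<open>Open walks and open paths\<close>

text \<open>Unblocked paths in a form suited to list induction: the condition at an inner vertex is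
  read off from three consecutive vertices.\<close>

fun open_path :: "('n \<times> 'n) set \<Rightarrow> 'n set \<Rightarrow> 'n list \<Rightarrow> bool" where
  "open_path E K [] \<longleftrightarrow> False"
| "open_path E K [x] \<longleftrightarrow> True"
| "open_path E K (x # y # zs) \<longleftrightarrow> ((x, y) \<in> E \<or> (y, x) \<in> E) \<and> x \<notin> set (y # zs) \<and>
     (case zs of [] \<Rightarrow> True | z # _ \<Rightarrow>
        if (x, y) \<in> E \<and> (z, y) \<in> E then y \<in> anc E K else y \<notin> K) \<and>
     open_path E K (y # zs)"

lemma is_path_Cons:
  "is_path E (x # y # zs) \<longleftrightarrow> ((x, y) \<in> E \<or> (y, x) \<in> E) \<and> x \<notin> set (y # zs) \<and> is_path E (y # zs)"
proof -
  have split: "(\<forall>k. Q k) \<longleftrightarrow> Q 0 \<and> (\<forall>k. Q (Suc k))" for Q :: "nat \<Rightarrow> bool"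
    by (metis not0_implies_Suc)
  show ?thesis
    unfolding is_path_def by (subst split) auto
qed

lemma notin_anc_iff: "x \<notin> anc E K \<longleftrightarrow> x \<notin> K \<and> de E x \<inter> K = {}"
  unfolding anc_def de_def by (auto simp: rtrancl_eq_or_trancl)

lemma blocked_Cons:
  "blocked E K (x # y # z # zs) \<longleftrightarrow>
     (if (x, y) \<in> E \<and> (z, y) \<in> E then y \<notin> anc E K else y \<in> K) \<or> blocked E K (y # z # zs)"
proof -
  let ?P = "\<lambda>xs k. 0 < k \<and> Suc k < length xs \<and> ((\<not> collider E xs k \<and> xs ! k \<in> K) \<or>
      (collider E xs k \<and> xs ! k \<notin> K \<and> de E (xs ! k) \<inter> K = {}))"
  let ?xs = "x # y # z # zs"
  have shift: "?P ?xs (Suc (Suc k)) \<longleftrightarrow> ?P (y # z # zs) (Suc k)" for k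
    by (simp add: collider_def)
  have one: "?P ?xs (Suc 0) \<longleftrightarrow> (if (x, y) \<in> E \<and> (z, y) \<in> E then y \<notin> anc E K else y \<in> K)"
    by (auto simp: collider_def notin_anc_iff)
  have split: "(\<exists>k. Q k) \<longleftrightarrow> Q 0 \<or> (\<exists>k. Q (Suc k))" for Q :: "nat \<Rightarrow> bool"
    by (metis not0_implies_Suc)
  \<comment> \<open>Positions 0 and 1 are split off; position 0 is never an inner one.\<close>
  have "blocked E K ?xs \<longleftrightarrow> ?P ?xs (Suc 0) \<or> (\<exists>k. ?P ?xs (Suc (Suc k)))"
    unfolding blocked_def by (subst split, subst split) blast
  moreover have "blocked E K (y # z # zs) \<longleftrightarrow> (\<exists>k. ?P (y # z # zs) (Suc k))"
    unfolding blocked_def by (subst split) blast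
  ultimately show ?thesis unfolding one shift by blast
qed

lemma open_path_iff: "open_path E K xs \<longleftrightarrow> is_path E xs \<and> \<not> blocked E K xs"
proof (induction E K xs rule: open_path.induct)
  case (1 E K)
  then show ?case by (simp add: is_path_def)
next
  case (2 E K x)
  then show ?case by (simp add: is_path_def blocked_def)
next
  case (3 E K x y zs)
  show ?case
  proof (cases zs)
    case Nil
    have "\<not> blocked E K [x, y]" "\<not> blocked E K [y]" by (auto simp: blocked_def)
    then show ?thesis using Nil 3 by (simp add: is_path_Cons)
  next
    case (Cons z ws)
    have "open_path E K (x # y # z # ws) \<longleftrightarrow> is_path E (x # y # z # ws) \<and> \<not> blocked E K (x # y # z # ws)"
      unfolding open_path.simps(3)[of E K x] is_path_Cons[of E x y "z # ws"] blocked_Cons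
      using 3 unfolding Cons list.case by (simp only: if_bool_eq_conj) blast
    then show ?thesis unfolding Cons .
  qed
qed

lemma acyclic_asym: "acyclic E \<Longrightarrow> (x, y) \<in> E \<Longrightarrow> (y, x) \<notin> E"
  by (metis acyclic_def r_into_trancl trancl_trans)

text \<open>The ball runs from the last vertex \<open>a\<close> of the list towards its head, so the
  direction of the first edge gives the flag at \<open>x\<close>.\<close>

lemma open_path_bball:
  assumes dag: "acyclic E" and a: "a \<notin> K"
    and "open_path E K (x # y # zs)" "last (y # zs) = a"
  shows "((y, x) \<in> E \<longrightarrow> bball E K a True x) \<and> ((x, y) \<in> E \<longrightarrow> x \<notin> K \<longrightarrow> bball E K a False x)"
  using assms(3,4)
proof (induction zs arbitrary: x y)
  case Nil
  then have "bball E K a False y" "y \<notin> K" using a by (auto intro: bball.start)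
  then show ?case by (metis bball.down bball.up)
next
  case (Cons z ws)
  have IH: "(z, y) \<in> E \<longrightarrow> bball E K a True y" "(y, z) \<in> E \<longrightarrow> y \<notin> K \<longrightarrow> bball E K a False y"
    using Cons by auto
  have adj: "(y, z) \<in> E \<or> (z, y) \<in> E" using Cons.prems by auto
  have c: "if (x, y) \<in> E \<and> (z, y) \<in> E then y \<in> anc E K else y \<notin> K" using Cons.prems by auto
  show ?case
  proof (intro conjI impI)
    assume "(y, x) \<in> E"
    then have "y \<notin> K" using c acyclic_asym[OF dag] by (auto split: if_splits)
    then show "bball E K a True x" using IH adj \<open>(y, x) \<in> E\<close> by (metis bball.down)
  next
    assume x: "(x, y) \<in> E" "x \<notin> K"
    show "bball E K a False x"
    proof (cases "(z, y) \<in> E")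
      case True
      then show ?thesis using x c IH by (metis bball.collide)
    next
      case False
      then show ?thesis using x c IH adj by (metis bball.up)
    qed
  qed
qed

text \<open>Shortening a walk to a path may change the edge at its head, so the flag need not match
  that edge. For the flag \<open>False\<close> this property keeps the path open when
  \<open>up\<close> makes its head a collider.\<close>

definition head_anc :: "('n \<times> 'n) set \<Rightarrow> 'n set \<Rightarrow> 'n list \<Rightarrow> bool" where
  "head_anc E K xs \<longleftrightarrow> (\<forall>x y zs. xs = x # y # zs \<longrightarrow> (y, x) \<in> E \<longrightarrow> x \<in> anc E K)"

text \<open>The counterpart for the flag \<open>True\<close>: it keeps the path open when
  \<open>collide\<close> makes its head a non-collider.\<close>

definition tail_notin :: "('n \<times> 'n) set \<Rightarrow> 'n set \<Rightarrow> 'n list \<Rightarrow> bool" where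
  "tail_notin E K xs \<longleftrightarrow> (\<forall>x y zs. xs = x # y # zs \<longrightarrow> (x, y) \<in> E \<longrightarrow> x \<notin> K)"

text \<open>If the next edge points into the new head, this vertex was an open collider or is a
  parent of its predecessor; in the second case the predecessor is an ancestor of \<open>K\<close>
  by the invariant.\<close>

lemma truncate_head:
  assumes "open_path E K xs" "head_anc E K xs" "y \<in> set xs"
  shows "\<exists>ys. open_path E K (y # ys) \<and> last (y # ys) = last xs \<and> head_anc E K (y # ys)"
  using assms
proof (induction xs)
  case (Cons x xs)
  show ?case
  proof (cases "y = x")
    case True
    then show ?thesis using Cons.prems by auto
  next
    case False
    then obtain z zs where xs: "xs = z # zs" using Cons.prems by (cases xs) auto
    have "head_anc E K xs"
      unfolding head_anc_def
    proof (intro allI impI)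
      fix z' w ws assume w: "xs = z' # w # ws" "(w, z') \<in> E"
      then have c: "if (x, z') \<in> E then z' \<in> anc E K else z' \<notin> K" "(x, z') \<in> E \<or> (z', x) \<in> E"
        using Cons.prems(1) by auto
      show "z' \<in> anc E K"
      proof (cases "(x, z') \<in> E")
        case True
        then show ?thesis using c by simp
      next
        case False
        then have "(z', x) \<in> E" using c by simp
        moreover then have "x \<in> anc E K" using Cons.prems(2) w by (simp add: head_anc_def)
        ultimately show ?thesis by (rule anc_step)
      qed
    qed
    moreover have "open_path E K xs" using Cons.prems(1) xs by simp
    ultimately show ?thesis using Cons.IH Cons.prems(3) False xs by simp
  qed
qed simp

text \<open>A new head whose next edge leaves it was a non-collider of the longer path, hence lies
  outside \<open>K\<close>.\<close>

lemma truncate_tail: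
  assumes dag: "acyclic E" and "open_path E K xs" "tail_notin E K xs" "y \<in> set xs"
  shows "\<exists>ys. open_path E K (y # ys) \<and> last (y # ys) = last xs \<and> tail_notin E K (y # ys)"
  using assms(2-4)
proof (induction xs)
  case (Cons x xs)
  show ?case
  proof (cases "y = x")
    case True
    then show ?thesis using Cons.prems by auto
  next
    case False
    then obtain z zs where xs: "xs = z # zs" using Cons.prems by (cases xs) auto
    have "tail_notin E K xs"
      unfolding tail_notin_def
    proof (intro allI impI)
      fix z' w ws assume w: "xs = z' # w # ws" "(z', w) \<in> E"
      then have "(w, z') \<notin> E" using acyclic_asym[OF dag] by blast
      then show "z' \<notin> K" using Cons.prems(1) w by auto
    qed
    moreover have "open_path E K xs" using Cons.prems(1) xs by simp
    ultimately show ?thesis using Cons.IH Cons.prems(3) False xs by simp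
  qed
qed simp

text \<open>When the ball returns to a vertex of the path, the path is cut there. The rule supplies
  the invariant for the cut: \<open>x\<close> is outside \<open>K\<close> in \<open>down\<close> and
  an ancestor of \<open>K\<close> in \<open>collide\<close>.\<close>

lemma bball_open_path:
  assumes dag: "acyclic E" and "bball E K a h x"
  shows "\<exists>xs. open_path E K (x # xs) \<and> last (x # xs) = a \<and>
    (if h then tail_notin E K (x # xs) else head_anc E K (x # xs))"
  using assms(2)
proof (induction rule: bball.induct)
  case start
  show ?case by (rule exI[of _ "[]"]) (simp add: head_anc_def)
next
  case (down h x y)
  then obtain xs where xs: "open_path E K (x # xs)" "last (x # xs) = a" by blast
  have yx: "(y, x) \<notin> E" using acyclic_asym[OF dag] down by blast
  show ?case
  proof (cases "y \<in> set (x # xs)")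
    case True
    have "tail_notin E K (x # xs)" using down by (simp add: tail_notin_def)
    then show ?thesis using truncate_tail[OF dag xs(1) _ True] xs(2) by simp
  next
    case False
    then have "open_path E K (y # x # xs)" using xs(1) down yx by (auto split: list.split)
    moreover have "tail_notin E K (y # x # xs)" using yx by (simp add: tail_notin_def)
    ultimately show ?thesis using xs(2) by (intro exI[of _ "x # xs"]) simp
  qed
next
  case (up x y)
  then obtain xs where xs: "open_path E K (x # xs)" "last (x # xs) = a" "head_anc E K (x # xs)"
    by auto
  have x: "x \<notin> K" using bball_False_notin[OF up(1)] by simp
  show ?case
  proof (cases "y \<in> set (x # xs)")
    case True
    then show ?thesis using truncate_head[OF xs(1,3) True] xs(2) by simp
  next
    case False
    then have "open_path E K (y # x # xs)" using xs(1,3) up x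
      by (auto simp: head_anc_def split: list.split)
    moreover have "head_anc E K (y # x # xs)"
      using acyclic_asym[OF dag] up by (auto simp: head_anc_def)
    ultimately show ?thesis using xs(2) by (intro exI[of _ "x # xs"]) simp
  qed
next
  case (collide x y)
  then obtain xs where xs: "open_path E K (x # xs)" "last (x # xs) = a" "tail_notin E K (x # xs)"
    by auto
  show ?case
  proof (cases "y \<in> set (x # xs)")
    case True
    have "head_anc E K (x # xs)" using collide by (simp add: head_anc_def)
    then show ?thesis using truncate_head[OF xs(1) _ True] xs(2) by simp
  next
    case False
    then have "open_path E K (y # x # xs)" using xs(1,3) collide
      by (auto simp: tail_notin_def split: list.split)
    moreover have "head_anc E K (y # x # xs)"
      using acyclic_asym[OF dag] collide by (auto simp: head_anc_def)
    ultimately show ?thesis using xs(2) by (intro exI[of _ "x # xs"]) simp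
  qed
qed

lemma dsep_iff_not_dconn:
  assumes dag: "acyclic E" and "i \<noteq> j" "i \<notin> K" "j \<notin> K"
  shows "dsep E K {i} {j} \<longleftrightarrow> \<not> dconn E K j i"
proof -
  have "dconn E K j i \<longleftrightarrow> (\<exists>xs. open_path E K xs \<and> hd xs = i \<and> last xs = j)"
  proof
    assume "dconn E K j i"
    then obtain h xs where "open_path E K (i # xs)" "last (i # xs) = j"
      unfolding dconn_def using bball_open_path[OF dag] by blast
    then show "\<exists>xs. open_path E K xs \<and> hd xs = i \<and> last xs = j"
      by (intro exI[of _ "i # xs"]) simp
  next
    assume "\<exists>xs. open_path E K xs \<and> hd xs = i \<and> last xs = j"
    then obtain xs where xs: "open_path E K xs" "hd xs = i" "last xs = j" by blast
    then obtain y zs where "xs = i # y # zs"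
      using assms(2) by (cases xs; cases "tl xs") auto
    then show "dconn E K j i"
      using open_path_bball[OF dag assms(4), of i y zs] xs assms(3) unfolding dconn_def by auto
  qed
  then show ?thesis unfolding dsep_def open_path_iff by blast
qed

section \<open>Generic conditional covariances\<close>

definition polyfun1 :: "(real \<Rightarrow> real) \<Rightarrow> bool" where
  "polyfun1 f \<longleftrightarrow> (\<exists>p. \<forall>t. f t = poly p t)"

lemma polyfun1_const: "polyfun1 (\<lambda>t. c)"
  unfolding polyfun1_def by (rule exI[of _ "[:c:]"]) simp

lemma polyfun1_id: "polyfun1 (\<lambda>t. t)"
  unfolding polyfun1_def by (rule exI[of _ "[:0, 1:]"]) simp

lemma polyfun1_add: "polyfun1 f \<Longrightarrow> polyfun1 g \<Longrightarrow> polyfun1 (\<lambda>t. f t + g t)"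
  unfolding polyfun1_def by (metis poly_add)

lemma polyfun1_diff: "polyfun1 f \<Longrightarrow> polyfun1 g \<Longrightarrow> polyfun1 (\<lambda>t. f t - g t)"
  unfolding polyfun1_def by (metis poly_diff)

lemma polyfun1_mult: "polyfun1 f \<Longrightarrow> polyfun1 g \<Longrightarrow> polyfun1 (\<lambda>t. f t * g t)"
  unfolding polyfun1_def by (metis poly_mult)

lemma polyfun1_sum: "(\<And>x. x \<in> S \<Longrightarrow> polyfun1 (f x)) \<Longrightarrow> polyfun1 (\<lambda>t. \<Sum>x\<in>S. f x t)"
  by (induction S rule: infinite_finite_induct) (auto intro: polyfun1_const polyfun1_add)

lemma polyfun1_prod: "(\<And>x. x \<in> S \<Longrightarrow> polyfun1 (f x)) \<Longrightarrow> polyfun1 (\<lambda>t. \<Prod>x\<in>S. f x t)"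
  by (induction S rule: infinite_finite_induct) (auto intro: polyfun1_const polyfun1_mult)

lemmas polyfun1_intros = polyfun1_const polyfun1_id polyfun1_add polyfun1_diff polyfun1_mult
  polyfun1_sum polyfun1_prod

lemma polyfun1_common_nonzero:
  assumes "polyfun1 f" "polyfun1 g" "f s \<noteq> 0" "g t \<noteq> 0"
  shows "\<exists>x\<in>{0..1}. f x \<noteq> 0 \<and> g x \<noteq> 0"
proof -
  obtain p q where p: "\<And>t. f t = poly p t" and q: "\<And>t. g t = poly q t"
    using assms(1,2) by (auto simp: polyfun1_def)
  have "p * q \<noteq> 0" using assms(3,4) p q by auto
  then have "finite {x. poly (p * q) x = 0}" by (rule poly_roots_finite)
  moreover have "infinite {0..1::real}" by (simp add: infinite_Icc)
  ultimately have "\<not> {0..1} \<subseteq> {x. poly (p * q) x = 0}" using finite_subset by blast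
  then show ?thesis using p q by auto
qed

text \<open>The recursion along the DAG contains no division, so the inverse matrix is polynomial
  and not merely rational in \<open>t\<close>.\<close>

lemma polyfun1_effects:
  fixes E :: "('n::finite \<times> 'n) set" and L :: "real \<Rightarrow> real^'n^'n"
  assumes dag: "acyclic E" and sup: "\<And>t. supported E (L t)"
    and L: "\<And>x y. polyfun1 (\<lambda>t. L t $ x $ y)"
  shows "polyfun1 (\<lambda>t. effects (L t) $ x $ y)"
proof (induction y rule: wf_induct_rule[OF wf_dag[OF dag]])
  case (1 y)
  have "polyfun1 (\<lambda>t. effects (L t) $ x $ p * L t $ p $ y)" for p
  proof (cases "(p, y) \<in> E")
    case True
    then show ?thesis using 1 L by (intro polyfun1_mult) auto
  next
    case False
    then have "(\<lambda>t. effects (L t) $ x $ p * L t $ p $ y) = (\<lambda>t. 0)"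
      using sup by (auto simp: supported_def)
    then show ?thesis by (simp add: polyfun1_const)
  qed
  then show ?case
    by (subst effects_rec[OF dag sup]) (intro polyfun1_add polyfun1_const polyfun1_sum)
qed

lemma polyfun1_cdet:
  fixes M :: "real \<Rightarrow> real^'n^'n"
  assumes "\<And>x y. polyfun1 (\<lambda>t. M t $ x $ y)"
  shows "polyfun1 (\<lambda>t. cdet a b K (M t))"
  unfolding cdet_def gdet_def by (intro polyfun1_intros assms)

text \<open>One parameter point suffices: for \<open>a\<close> and \<open>b\<close> outside
  \<open>K\<close> the conditional covariance is, up to a positive factor, polynomial in the
  parameters.\<close>

definition generic :: "('n::finite \<times> 'n) set \<Rightarrow> 'n set \<Rightarrow> 'n \<Rightarrow> 'n \<Rightarrow> bool" where
  "generic E K a b \<longleftrightarrow> (\<exists>\<omega> \<Lambda>. params E \<omega> \<Lambda> \<and> ccov (phiG \<omega> \<Lambda>) K a b \<noteq> 0)"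

lemma cdet_nonzero_iff:
  assumes "spd M" "a \<notin> K" "b \<notin> K"
  shows "cdet a b K M \<noteq> 0 \<longleftrightarrow> ccov M K a b \<noteq> 0"
  using cdet_eq_ccov[OF assms] pdet_pos[OF assms(1), of K] by simp

text \<open>The parameter space is convex, so the segment between the two witnesses stays inside it,
  and two nonzero polynomials on it have a common nonzero point.\<close>

lemma generic_common:
  fixes E :: "('n::finite \<times> 'n) set"
  assumes dag: "acyclic E" and gen: "generic E K a b" "generic E K c d"
    and notin: "a \<notin> K" "b \<notin> K" "c \<notin> K" "d \<notin> K"
  shows "\<exists>\<omega> \<Lambda>. params E \<omega> \<Lambda> \<and> ccov (phiG \<omega> \<Lambda>) K a b \<noteq> 0 \<and> ccov (phiG \<omega> \<Lambda>) K c d \<noteq> 0"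
proof -
  obtain \<omega>0 \<Lambda>0 \<omega>1 \<Lambda>1 where
    p0: "params E \<omega>0 \<Lambda>0" "ccov (phiG \<omega>0 \<Lambda>0) K a b \<noteq> 0" and
    p1: "params E \<omega>1 \<Lambda>1" "ccov (phiG \<omega>1 \<Lambda>1) K c d \<noteq> 0"
    using gen by (auto simp: generic_def)
  define w where "w t i = (1 - t) * \<omega>0 i + t * \<omega>1 i" for t i
  define L :: "real \<Rightarrow> real^'n^'n"
    where "L t = (\<chi> x y. (1 - t) * \<Lambda>0 $ x $ y + t * \<Lambda>1 $ x $ y)" for t
  have sup: "supported E (L t)" for t
    using p0(1) p1(1) by (auto simp: L_def params_iff supported_def)
  have par: "params E (w t) (L t)" if "t \<in> {0..1}" for t
  proof -
    have "w t i > 0" for i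
    proof -
      have "\<omega>0 i > 0" "\<omega>1 i > 0" using p0(1) p1(1) by (auto simp: params_def)
      then show ?thesis using that unfolding w_def
        by (cases "t = 0") (auto intro: add_nonneg_pos)
    qed
    then show ?thesis using sup by (simp add: params_iff)
  qed
  have L01: "w 0 = \<omega>0" "L 0 = \<Lambda>0" "w 1 = \<omega>1" "L 1 = \<Lambda>1"
    by (auto simp: w_def L_def vec_eq_iff)
  have "polyfun1 (\<lambda>t. L t $ x $ y)" for x y
    unfolding L_def by (simp, intro polyfun1_intros)
  then have eff: "polyfun1 (\<lambda>t. effects (L t) $ x $ y)" for x y
    by (rule polyfun1_effects[OF dag sup])
  have phi: "polyfun1 (\<lambda>t. phiG (w t) (L t) $ x $ y)" for x y
    unfolding phiG_entry w_def by (intro polyfun1_intros eff)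
  \<comment> \<open>The conditional covariance is only rational in \<open>t\<close>; the polynomial
    \<open>cdet\<close> vanishes at the same parameters and takes its place.\<close>
  have 0: "cdet a b K (phiG (w 0) (L 0)) \<noteq> 0"
    using p0 cdet_nonzero_iff[OF spd_phiG[OF dag p0(1)] notin(1,2)] by (simp add: L01)
  have 1: "cdet c d K (phiG (w 1) (L 1)) \<noteq> 0"
    using p1 cdet_nonzero_iff[OF spd_phiG[OF dag p1(1)] notin(3,4)] by (simp add: L01)
  obtain t where t: "t \<in> {0..1}" "cdet a b K (phiG (w t) (L t)) \<noteq> 0"
     "cdet c d K (phiG (w t) (L t)) \<noteq> 0"
    using polyfun1_common_nonzero[OF polyfun1_cdet[OF phi] polyfun1_cdet[OF phi] 0 1] by blast
  have spd: "spd (phiG (w t) (L t))" using spd_phiG[OF dag par[OF t(1)]] .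
  show ?thesis
    using par[OF t(1)] t(2,3) cdet_nonzero_iff[OF spd notin(1,2)] cdet_nonzero_iff[OF spd notin(3,4)]
    by blast
qed

lemma generic_sym:
  assumes "acyclic E" "a \<notin> K" "b \<notin> K"
  shows "generic E K a b \<longleftrightarrow> generic E K b a"
  unfolding generic_def using ccov_sym[OF spd_phiG[OF assms(1)] assms(2,3)] by metis

lemma generic_refl:
  assumes "acyclic E" "a \<notin> K"
  shows "generic E K a a"
proof -
  have p: "params E (\<lambda>_. 1) 0" by (simp add: params_def)
  then show ?thesis
    unfolding generic_def using ccov_pos[OF spd_phiG[OF assms(1) p] assms(2)] by force
qed

lemma generic_empty:
  assumes "a \<notin> K" "b \<notin> K" "a \<noteq> b"
  shows "\<not> generic {} K a b"
proof
  assume "generic {} K a b"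
  then obtain \<omega> \<Lambda> where p: "params {} \<omega> \<Lambda>" and nz: "ccov (phiG \<omega> \<Lambda>) K a b \<noteq> 0"
    by (auto simp: generic_def)
  have dag: "acyclic {}" by (simp add: acyclic_def)
  have "insert a K \<inter> deb {} b = {}" using assms by (auto simp: deb_def de_def)
  from ccov_nondesc[OF dag p assms(1) this] p
  have "ccov (phiG \<omega> \<Lambda>) K a b = 0" by (simp add: params_def)
  then show False using nz by simp
qed

lemma generic_mono: "generic E K a b \<Longrightarrow> E \<subseteq> F \<Longrightarrow> generic F K a b"
  unfolding generic_def params_iff using supported_mono by blast

section \<open>Removing a sink from the model\<close>

lemma ccov_sink_other:
  fixes E :: "('n::finite \<times> 'n) set"
  assumes dag: "acyclic E" and sink: "\<And>y. (v, y) \<notin> E"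
    and par: "params E \<omega> \<Lambda>" "params E \<omega> \<Lambda>'"
    and eq: "\<And>x y. y \<noteq> v \<Longrightarrow> \<Lambda> $ x $ y = \<Lambda>' $ x $ y"
    and "a \<notin> K" "v \<notin> insert a K" "b \<noteq> v"
  shows "ccov (phiG \<omega> \<Lambda>) K a b = ccov (phiG \<omega> \<Lambda>') K a b"
proof (rule ccov_cong[OF spd_phiG[OF dag par(1)] spd_phiG[OF dag par(2)] assms(6)])
  fix x y assume "x \<in> insert b (insert a K)" "y \<in> insert a K"
  then have "x \<in> - {v}" "y \<in> - {v}" using assms(7,8) by auto
  then show "phiG \<omega> \<Lambda> $ x $ y = phiG \<omega> \<Lambda>' $ x $ y"
    by (intro phiG_cong[OF dag, where W = "- {v}"])
      (use par sink eq in \<open>auto simp: params_iff\<close>)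
qed

text \<open>With column \<open>v\<close> of \<open>\<Lambda>'\<close> set to zero, the right side is
  a linear form in column \<open>v\<close> of \<Lambda> whose coefficients come from the cut
  graph.\<close>

lemma ccov_sink:
  fixes E :: "('n::finite \<times> 'n) set"
  assumes dag: "acyclic E" and sink: "\<And>y. (v, y) \<notin> E"
    and par: "params E \<omega> \<Lambda>" "params E \<omega> \<Lambda>'"
    and eq: "\<And>x y. y \<noteq> v \<Longrightarrow> \<Lambda> $ x $ y = \<Lambda>' $ x $ y"
    and "a \<notin> K" "v \<notin> insert a K"
  shows "ccov (phiG \<omega> \<Lambda>) K a v = (\<Sum>p\<in>UNIV. \<Lambda> $ p $ v * ccov (phiG \<omega> \<Lambda>') K a p)"
proof -
  have "deb E v = {v}" using sink by (auto simp: deb_def de_def dest: tranclD)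
  then have "ccov (phiG \<omega> \<Lambda>) K a v = (\<Sum>p\<in>UNIV. \<Lambda> $ p $ v * ccov (phiG \<omega> \<Lambda>) K a p)"
    using ccov_nondesc[OF dag par(1) assms(6), of v] assms(7) by auto
  also have "\<dots> = (\<Sum>p\<in>UNIV. \<Lambda> $ p $ v * ccov (phiG \<omega> \<Lambda>') K a p)"
  proof (intro sum.cong refl)
    fix p
    show "\<Lambda> $ p $ v * ccov (phiG \<omega> \<Lambda>) K a p = \<Lambda> $ p $ v * ccov (phiG \<omega> \<Lambda>') K a p"
    proof (cases "p = v")
      case True
      then have "\<Lambda> $ p $ v = 0" using sink par(1) by (simp add: params_def)
      then show ?thesis by simp
    next
      case False
      then show ?thesis using ccov_sink_other[OF assms] by simp
    qed
  qed
  finally show ?thesis .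
qed

definition set_col :: "'n \<Rightarrow> ('n \<Rightarrow> real) \<Rightarrow> real^'n^'n \<Rightarrow> real^'n^'n" where
  "set_col v c \<Lambda> = (\<chi> x y. if y = v then c x else \<Lambda> $ x $ y)"

lemma set_col_simps [simp]:
  "set_col v c \<Lambda> $ x $ v = c x" "y \<noteq> v \<Longrightarrow> set_col v c \<Lambda> $ x $ y = \<Lambda> $ x $ y"
  by (simp_all add: set_col_def)

lemma params_cut: "params E \<omega> \<Lambda> \<Longrightarrow> params (cut v E) \<omega> (set_col v (\<lambda>_. 0) \<Lambda>)"
  by (auto simp: params_def cut_def set_col_def)

lemma params_cut_mono: "params (cut v E) \<omega> \<Lambda> \<Longrightarrow> params E \<omega> \<Lambda>"
  by (auto simp: params_def cut_def)

lemma params_set_col: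
  "params (cut v E) \<omega> \<Lambda> \<Longrightarrow> (\<And>x. c x \<noteq> 0 \<Longrightarrow> (x, v) \<in> E) \<Longrightarrow> params E \<omega> (set_col v c \<Lambda>)"
  by (auto simp: params_def cut_def set_col_def)

lemma generic_sink_other:
  assumes dag: "acyclic E" and sink: "\<And>y. (v, y) \<notin> E" and "a \<notin> K" "v \<notin> K" "v \<noteq> a" "v \<noteq> b"
  shows "generic E K a b \<longleftrightarrow> generic (cut v E) K a b"
proof
  assume "generic E K a b"
  then obtain \<omega> \<Lambda> where p: "params E \<omega> \<Lambda>" and nz: "ccov (phiG \<omega> \<Lambda>) K a b \<noteq> 0"
    by (auto simp: generic_def)
  have "ccov (phiG \<omega> \<Lambda>) K a b = ccov (phiG \<omega> (set_col v (\<lambda>_. 0) \<Lambda>)) K a b"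
    using assms by (intro ccov_sink_other[OF dag sink p params_cut_mono[OF params_cut[OF p]]]) auto
  then show "generic (cut v E) K a b"
    unfolding generic_def using nz params_cut[OF p] by metis
next
  assume "generic (cut v E) K a b"
  then show "generic E K a b" by (rule generic_mono) (rule cut_subset)
qed

lemma generic_sink_right:
  assumes dag: "acyclic E" and sink: "\<And>y. (b, y) \<notin> E" and "a \<notin> K" "b \<notin> K" "b \<noteq> a"
  shows "generic E K a b \<longleftrightarrow> (\<exists>p. (p, b) \<in> E \<and> p \<notin> K \<and> generic (cut b E) K a p)"
proof
  assume "generic E K a b"
  then obtain \<omega> \<Lambda> where p: "params E \<omega> \<Lambda>" and nz: "ccov (phiG \<omega> \<Lambda>) K a b \<noteq> 0"
    by (auto simp: generic_def)
  let ?L = "set_col b (\<lambda>_. 0) \<Lambda>"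
  have pc: "params (cut b E) \<omega> ?L" by (rule params_cut[OF p])
  have "ccov (phiG \<omega> \<Lambda>) K a b = (\<Sum>p\<in>UNIV. \<Lambda> $ p $ b * ccov (phiG \<omega> ?L) K a p)"
    using assms by (intro ccov_sink[OF dag sink p params_cut_mono[OF pc]]) auto
  then obtain q where q: "\<Lambda> $ q $ b * ccov (phiG \<omega> ?L) K a q \<noteq> 0"
    using nz by (metis (mono_tags, lifting) sum.neutral)
  then have "(q, b) \<in> E" using p by (auto simp: params_def)
  moreover have "q \<notin> K"
    using q ccov_in[OF spd_phiG[OF dag params_cut_mono[OF pc]] assms(3)] by auto
  moreover have "generic (cut b E) K a q" unfolding generic_def using pc q by auto
  ultimately show "\<exists>p. (p, b) \<in> E \<and> p \<notin> K \<and> generic (cut b E) K a p" by blast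
next
  assume "\<exists>p. (p, b) \<in> E \<and> p \<notin> K \<and> generic (cut b E) K a p"
  then obtain q \<omega> \<Lambda> where q: "(q, b) \<in> E" "q \<notin> K" and pc: "params (cut b E) \<omega> \<Lambda>"
    and nz: "ccov (phiG \<omega> \<Lambda>) K a q \<noteq> 0" by (auto simp: generic_def)
  \<comment> \<open>Only the edge from \<open>q\<close> gets a coefficient, so no other parent can
    cancel its contribution.\<close>
  let ?L = "set_col b (\<lambda>x. if x = q then 1 else 0) \<Lambda>"
  have p: "params E \<omega> ?L" using q by (intro params_set_col[OF pc]) (auto split: if_splits)
  have "ccov (phiG \<omega> ?L) K a b = (\<Sum>p\<in>UNIV. ?L $ p $ b * ccov (phiG \<omega> \<Lambda>) K a p)"
    using assms by (intro ccov_sink[OF dag sink p params_cut_mono[OF pc]]) auto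
  also have "\<dots> = (\<Sum>p\<in>UNIV. if p = q then ccov (phiG \<omega> \<Lambda>) K a p else 0)"
    by (intro sum.cong refl) simp
  also have "\<dots> \<noteq> 0" using nz by simp
  finally show "generic E K a b" unfolding generic_def using p by blast
qed

text \<open>The correction for \<open>v\<close> has as numerator a product of two linear forms in
  column \<open>v\<close>, whose entries at the parents of \<open>v\<close> can be chosen after all
  other parameters.\<close>

lemma generic_sink_in:
  assumes dag: "acyclic E" and sink: "\<And>y. (v, y) \<notin> E" and v: "v \<notin> K"
    and a: "a \<notin> insert v K" and b: "b \<notin> insert v K"
  shows "generic E (insert v K) a b \<longleftrightarrow> generic (cut v E) K a b \<or>
    (\<exists>p q. (p, v) \<in> E \<and> p \<notin> K \<and> generic (cut v E) K a p \<and> (q, v) \<in> E \<and> q \<notin> K \<and> generic (cut v E) K q b)"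
proof -
  have dag': "acyclic (cut v E)" using dag cut_subset by (rule acyclic_subset)
  have formula: "ccov (phiG \<omega> \<Lambda>) (insert v K) a b = ccov (phiG \<omega> \<Lambda>') K a b -
      (\<Sum>p\<in>UNIV. \<Lambda> $ p $ v * ccov (phiG \<omega> \<Lambda>') K a p) *
      (\<Sum>q\<in>UNIV. \<Lambda> $ q $ v * ccov (phiG \<omega> \<Lambda>') K b q) / ccov (phiG \<omega> \<Lambda>) K v v"
    if "params E \<omega> \<Lambda>" "params E \<omega> \<Lambda>'" "\<And>x y. y \<noteq> v \<Longrightarrow> \<Lambda> $ x $ y = \<Lambda>' $ x $ y" for \<omega> \<Lambda> \<Lambda>'
  proof -
    have spd: "spd (phiG \<omega> \<Lambda>)" by (rule spd_phiG[OF dag that(1)])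
    have "ccov (phiG \<omega> \<Lambda>) K a b = ccov (phiG \<omega> \<Lambda>') K a b"
      by (rule ccov_sink_other[OF dag sink that]) (use a b v in auto)
    moreover have "ccov (phiG \<omega> \<Lambda>) K a v = (\<Sum>p\<in>UNIV. \<Lambda> $ p $ v * ccov (phiG \<omega> \<Lambda>') K a p)"
      by (rule ccov_sink[OF dag sink that]) (use a v in auto)
    moreover have "ccov (phiG \<omega> \<Lambda>) K v b = (\<Sum>p\<in>UNIV. \<Lambda> $ p $ v * ccov (phiG \<omega> \<Lambda>') K b p)"
      by (subst ccov_sym[OF spd v], use b in blast, rule ccov_sink[OF dag sink that])
        (use b v in auto)
    ultimately show ?thesis using ccov_insert[OF spd v a, of b] by simp
  qed
  show ?thesis
  proof
    assume "generic E (insert v K) a b"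
    then obtain \<omega> \<Lambda> where p: "params E \<omega> \<Lambda>" and nz: "ccov (phiG \<omega> \<Lambda>) (insert v K) a b \<noteq> 0"
      by (auto simp: generic_def)
    let ?L = "set_col v (\<lambda>_. 0) \<Lambda>"
    have pc: "params (cut v E) \<omega> ?L" by (rule params_cut[OF p])
    have pE: "params E \<omega> ?L" by (rule params_cut_mono[OF pc])
    have spd: "spd (phiG \<omega> ?L)" by (rule spd_phiG[OF dag pE])
    show "generic (cut v E) K a b \<or>
      (\<exists>p q. (p, v) \<in> E \<and> p \<notin> K \<and> generic (cut v E) K a p \<and> (q, v) \<in> E \<and> q \<notin> K \<and> generic (cut v E) K q b)"
    proof (cases "ccov (phiG \<omega> ?L) K a b = 0")
      case False
      then show ?thesis using pc unfolding generic_def by blast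
    next
      case True
      have "(\<Sum>p\<in>UNIV. \<Lambda> $ p $ v * ccov (phiG \<omega> ?L) K a p) \<noteq> 0"
        "(\<Sum>p\<in>UNIV. \<Lambda> $ p $ v * ccov (phiG \<omega> ?L) K b p) \<noteq> 0"
        using nz formula[OF p pE] True by auto
      then obtain q r where q: "\<Lambda> $ q $ v * ccov (phiG \<omega> ?L) K a q \<noteq> 0"
        and r: "\<Lambda> $ r $ v * ccov (phiG \<omega> ?L) K b r \<noteq> 0"
        by (metis (mono_tags, lifting) sum.neutral)
      have "(q, v) \<in> E" "(r, v) \<in> E" using q r p by (auto simp: params_def)
      moreover have "q \<notin> K" "r \<notin> K"
        using q r ccov_in[OF spd] a b by auto
      moreover have "generic (cut v E) K a q" "generic (cut v E) K b r"
        unfolding generic_def using pc q r by auto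
      moreover then have "generic (cut v E) K r b"
        using generic_sym[OF dag'] b \<open>r \<notin> K\<close> by blast
      ultimately show ?thesis by blast
    qed
  next
    assume "generic (cut v E) K a b \<or>
      (\<exists>p q. (p, v) \<in> E \<and> p \<notin> K \<and> generic (cut v E) K a p \<and> (q, v) \<in> E \<and> q \<notin> K \<and> generic (cut v E) K q b)"
    \<comment> \<open>With column \<open>v\<close> zero both linear forms vanish, so conditioning on
      \<open>v\<close> changes nothing.\<close>
    moreover have unconn: "generic E (insert v K) a b"
      if pc: "params (cut v E) \<omega> \<Lambda>" and nz: "ccov (phiG \<omega> \<Lambda>) K a b \<noteq> 0" for \<omega> \<Lambda>
    proof -
      have pE: "params E \<omega> \<Lambda>" by (rule params_cut_mono[OF pc])
      have "\<Lambda> $ x $ v = 0" for x using pc by (simp add: params_def cut_def)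
      then have "ccov (phiG \<omega> \<Lambda>) (insert v K) a b \<noteq> 0" using formula[OF pE pE] nz by simp
      then show ?thesis unfolding generic_def using pE by blast
    qed
    moreover have "generic E (insert v K) a b"
      if p: "(p, v) \<in> E" "p \<notin> K" "generic (cut v E) K a p"
        and q: "(q, v) \<in> E" "q \<notin> K" "generic (cut v E) K q b" for p q
    proof -
      obtain \<omega> \<Lambda> where pc: "params (cut v E) \<omega> \<Lambda>"
        and nzp: "ccov (phiG \<omega> \<Lambda>) K a p \<noteq> 0" and nzq: "ccov (phiG \<omega> \<Lambda>) K q b \<noteq> 0"
        using generic_common[OF dag' p(3) q(3)] a b p q by auto
      have pE: "params E \<omega> \<Lambda>" by (rule params_cut_mono[OF pc])
      have nzq: "ccov (phiG \<omega> \<Lambda>) K b q \<noteq> 0"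
        using nzq ccov_sym[OF spd_phiG[OF dag pE] q(2)] b by auto
      show ?thesis
      proof (cases "ccov (phiG \<omega> \<Lambda>) K a b = 0")
        case False
        then show ?thesis using unconn pc by blast
      next
        case True
        define s where "s = ccov (phiG \<omega> \<Lambda>) K"
        have gen: "generic E (insert v K) a b"
          if c: "\<And>x. c x \<noteq> 0 \<Longrightarrow> x = p \<or> x = q"
            and nz: "(\<Sum>x\<in>UNIV. c x * s a x) \<noteq> 0" "(\<Sum>x\<in>UNIV. c x * s b x) \<noteq> 0"
          for c
        proof -
          have pc': "params E \<omega> (set_col v c \<Lambda>)"
            using c p q by (intro params_set_col[OF pc]) auto
          have "ccov (phiG \<omega> (set_col v c \<Lambda>)) K v v \<noteq> 0"
            using ccov_pos[OF spd_phiG[OF dag pc'] v] by simp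
          then have "ccov (phiG \<omega> (set_col v c \<Lambda>)) (insert v K) a b \<noteq> 0"
            using formula[OF pc' pE] nz True by (simp add: s_def)
          then show ?thesis unfolding generic_def using pc' by blast
        qed
        have one: "(\<Sum>x\<in>UNIV. (if x = z then 1 else 0) * f x) = f z" for z :: 'a and f :: "'a \<Rightarrow> real"
          by (simp add: if_distrib[of "\<lambda>c. c * _"] cong: if_cong)
        \<comment> \<open>The two forms take the values \<open>s a p\<close>, \<open>s b p\<close>
          on the unit column at \<open>p\<close>, and \<open>s a q\<close>, \<open>s b q\<close> on
          the one at \<open>q\<close>. If neither column makes both nonzero, the sum of the columns
          does, since the mixed values vanish.\<close>
        consider "s b p \<noteq> 0" | "s a q \<noteq> 0" | "s b p = 0" "s a q = 0" by blast
        then show ?thesis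
        proof cases
          case 1
          show ?thesis
            by (rule gen[of "\<lambda>x. if x = p then 1 else 0"])
              (use 1 nzp in \<open>auto simp: one s_def split: if_splits\<close>)
        next
          case 2
          show ?thesis
            by (rule gen[of "\<lambda>x. if x = q then 1 else 0"])
              (use 2 nzq in \<open>auto simp: one s_def split: if_splits\<close>)
        next
          case 3
          have "(\<Sum>x\<in>UNIV. ((if x = p then 1 else 0) + (if x = q then 1 else 0)) * f x) = f p + f q"
            for f :: "'a \<Rightarrow> real"
            by (simp only: distrib_right sum.distrib one)
          then show ?thesis
            by (intro gen[of "\<lambda>x. (if x = p then 1 else 0) + (if x = q then 1 else 0)"])
              (use 3 nzp nzq in \<open>auto simp: s_def split: if_splits\<close>)
        qed
      qed
    qed
    ultimately show "generic E (insert v K) a b" unfolding generic_def[of "cut v E"] by blast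
  qed
qed

text \<open>The sink is sought in the range of \<open>E\<close>, so that cutting it removes at least
  one edge.\<close>

lemma sink_exists:
  fixes E :: "('n::finite \<times> 'n) set"
  assumes "acyclic E" "E \<noteq> {}"
  obtains u v where "(u, v) \<in> E" "\<And>y. (v, y) \<notin> E"
proof -
  have "wf (E\<inverse>)" using assms(1) by (simp add: finite_acyclic_wf_converse)
  moreover obtain w where "w \<in> Range E" using assms(2) by auto
  ultimately obtain v where v: "v \<in> Range E" "\<And>y. (y, v) \<in> E\<inverse> \<Longrightarrow> y \<notin> Range E"
    by (rule wfE_min) blast
  then show ?thesis using that by blast
qed

text \<open>Induction on the number of edges: for every position of a sink relative to
  \<open>a\<close>, \<open>b\<close> and \<open>K\<close>, both sides obey the same
  recursion.\<close>

lemma generic_iff_dconn: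
  fixes E :: "('n::finite \<times> 'n) set"
  assumes "acyclic E" "a \<notin> K" "b \<notin> K"
  shows "generic E K a b \<longleftrightarrow> dconn E K a b"
  using assms
proof (induction "card E" arbitrary: E K a b rule: less_induct)
  case less
  note dag = less.prems(1)
  show ?case
  proof (cases "a = b")
    case True
    then show ?thesis using generic_refl bball_refl less.prems by metis
  next
    case ab: False
    show ?thesis
    proof (cases "E = {}")
      case True
      have "\<not> dconn {} K a b"
        using ab unfolding dconn_def by (auto elim: bball.cases)
      then show ?thesis using generic_empty less.prems ab True by blast
    next
      case False
      then obtain u v where uv: "(u, v) \<in> E" and sink: "\<And>y. (v, y) \<notin> E"
        using sink_exists[OF dag] by metis
      have "cut v E \<subset> E" using uv by (auto simp: cut_def)
      then have "card (cut v E) < card E" by (simp add: psubset_card_mono)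
      then have IH: "generic (cut v E) K' a' b' \<longleftrightarrow> dconn (cut v E) K' a' b'"
        if "a' \<notin> K'" "b' \<notin> K'" for K' a' b'
        using less.hyps[OF _ acyclic_subset[OF dag cut_subset] that] by blast
      consider "v \<in> K" | "v = a" | "v = b" | "v \<notin> K" "v \<noteq> a" "v \<noteq> b" by blast
      then show ?thesis
      proof cases
        case 1
        define K' where "K' = K - {v}"
        have K: "K = insert v K'" "v \<notin> K'" using 1 by (auto simp: K'_def)
        have ab': "a \<notin> insert v K'" "b \<notin> insert v K'" using less.prems K by auto
        have "a \<notin> K'" "b \<notin> K'" using ab' by auto
        then show ?thesis
          unfolding K(1) generic_sink_in[OF dag sink K(2) ab'] dconn_sink_in[OF sink K(2) ab']
          using IH by blast
      next
        case 2
        have "generic E K a b \<longleftrightarrow> (\<exists>p. (p, a) \<in> E \<and> p \<notin> K \<and> generic (cut a E) K b p)"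
          using generic_sym[OF less.prems] generic_sink_right[OF dag _ less.prems(3,2) ab] sink 2
          by blast
        also have "\<dots> \<longleftrightarrow> (\<exists>p. (p, a) \<in> E \<and> p \<notin> K \<and> dconn (cut a E) K p b)"
          using generic_sym[OF acyclic_subset[OF dag cut_subset]] IH less.prems 2 by blast
        also have "\<dots> \<longleftrightarrow> dconn E K a b"
          using dconn_sink_left[of a E K b] sink 2 less.prems ab by metis
        finally show ?thesis .
      next
        case 3
        have "generic E K a b \<longleftrightarrow> (\<exists>p. (p, b) \<in> E \<and> p \<notin> K \<and> generic (cut b E) K a p)"
          using generic_sink_right[OF dag _ less.prems(2,3)] ab sink 3 by blast
        also have "\<dots> \<longleftrightarrow> (\<exists>p. (p, b) \<in> E \<and> p \<notin> K \<and> dconn (cut b E) K a p)"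
          using IH less.prems 3 by blast
        also have "\<dots> \<longleftrightarrow> dconn E K a b"
          using dconn_sink_right[of b E K a] sink 3 less.prems ab by metis
        finally show ?thesis .
      next
        case 4
        then show ?thesis
          using generic_sink_other[OF dag sink less.prems(2) 4] dconn_sink_other[OF sink 4]
            IH[OF less.prems(2,3)] by blast
      qed
    qed
  qed
qed

lemma dsep_iff_ccov_zero:
  fixes E :: "('n::finite \<times> 'n) set"
  assumes "acyclic E" "i \<noteq> j" "i \<notin> K" "j \<notin> K"
  shows "dsep E K {i} {j} \<longleftrightarrow> (\<forall>\<omega> \<Lambda>. params E \<omega> \<Lambda> \<longrightarrow> ccov (phiG \<omega> \<Lambda>) K i j = 0)"
  using dsep_iff_not_dconn[OF assms] generic_iff_dconn[OF assms(1,4,3)]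
    generic_sym[OF assms(1,3,4)] unfolding generic_def[of E K i j] by blast

section \<open>Identification\<close>

lemma phiG_zero: "phiG \<omega> (0 :: real^'n^'n) $ x $ y = (if x = y then \<omega> x else 0)"
proof -
  have dag: "acyclic ({} :: ('n \<times> 'n) set)" by (simp add: acyclic_def)
  have sup: "supported {} (0 :: real^'n^'n)" by (simp add: supported_def)
  have eff: "effects (0 :: real^'n^'n) $ x $ y = (if x = y then 1 else 0)" for x y
    using effects_rec[OF dag sup, of x y] by simp
  show ?thesis using phiG_rec[OF dag sup, of \<omega> x y, unfolded eff] by simp
qed

text \<open>The isolated vertex \<open>y\<close> becomes a noisy copy of \<open>x\<close>: the
  variable of \<open>x\<close> plus the error of \<open>y\<close>.\<close>

lemma phiG_extend:
  fixes E :: "('n::finite \<times> 'n) set"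
  assumes dag: "acyclic E" and par: "params E \<omega> \<Lambda>" and xy: "(x, y) \<in> E"
    and zero: "\<And>p. \<Lambda> $ p $ y = 0" "\<And>p. \<Lambda> $ y $ p = 0"
  defines "\<Lambda>' \<equiv> set_col y (\<lambda>p. if p = x then 1 else 0) \<Lambda>"
  shows "params E \<omega> \<Lambda>'"
    and "a \<noteq> y \<Longrightarrow> b \<noteq> y \<Longrightarrow> phiG \<omega> \<Lambda>' $ a $ b = phiG \<omega> \<Lambda> $ a $ b"
    and "a \<noteq> y \<Longrightarrow> phiG \<omega> \<Lambda>' $ a $ y = phiG \<omega> \<Lambda> $ a $ x"
    and "phiG \<omega> \<Lambda>' $ y $ y = phiG \<omega> \<Lambda> $ x $ x + \<omega> y"
proof -
  have x: "x \<noteq> y" using xy acyclic_asym[OF dag] by blast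
  \<comment> \<open>In \<open>E\<close> the vertex \<open>y\<close> may have children; in the
    support \<open>F\<close> of the new coefficients it is a sink.\<close>
  define F where "F = {(p, q). \<Lambda>' $ p $ q \<noteq> 0}"
  show par': "params E \<omega> \<Lambda>'"
    using par xy by (auto simp: params_def \<Lambda>'_def set_col_def)
  have "F \<subseteq> E" using par' by (auto simp: F_def params_def)
  then have dagF: "acyclic F" by (rule acyclic_subset[OF dag])
  have sup': "supported F \<Lambda>'" by (auto simp: F_def supported_def)
  have sup: "supported F \<Lambda>"
    using zero by (auto simp: F_def supported_def \<Lambda>'_def set_col_def split: if_splits)
  have sink: "(y, q) \<notin> F" for q
    using zero x by (auto simp: F_def \<Lambda>'_def set_col_def)
  show agree: "phiG \<omega> \<Lambda>' $ a $ b = phiG \<omega> \<Lambda> $ a $ b" if "a \<noteq> y" "b \<noteq> y" for a b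
    by (rule phiG_cong[OF dagF sup' sup, where W = "- {y}"])
      (use sink that in \<open>auto simp: \<Lambda>'_def\<close>)
  have col: "(\<Sum>p\<in>UNIV. phiG \<omega> \<Lambda>' $ a $ p * \<Lambda>' $ p $ y) = phiG \<omega> \<Lambda>' $ a $ x" for a
  proof -
    have "(\<Sum>p\<in>UNIV. phiG \<omega> \<Lambda>' $ a $ p * \<Lambda>' $ p $ y)
        = (\<Sum>p\<in>UNIV. if p = x then phiG \<omega> \<Lambda>' $ a $ p else 0)"
      by (intro sum.cong refl) (simp add: \<Lambda>'_def)
    then show ?thesis by simp
  qed
  have deb: "deb F y = {y}" using sink by (auto simp: deb_def de_def dest: tranclD)
  show ay: "phiG \<omega> \<Lambda>' $ a $ y = phiG \<omega> \<Lambda> $ a $ x" if "a \<noteq> y" for a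
    using phiG_nondesc[OF dagF sup', of a y \<omega>] deb that agree x col by simp
  have "phiG \<omega> \<Lambda>' $ y $ y = phiG \<omega> \<Lambda>' $ y $ x + \<omega> y"
    using phiG_rec[OF dagF sup', of \<omega> y y] col effects_diag[OF dagF sup'] by simp
  also have "phiG \<omega> \<Lambda>' $ y $ x = phiG \<omega> \<Lambda> $ x $ x" using phiG_sym[of \<omega> \<Lambda>'] ay[OF x] by metis
  finally show "phiG \<omega> \<Lambda>' $ y $ y = phiG \<omega> \<Lambda> $ x $ x + \<omega> y" .
qed

text \<open>Noisy copies of \<open>j\<close> are passed along a directed path outside
  \<open>W\<close> and keep the covariances of \<open>j\<close> with \<open>W\<close>. The support
  stays among the ancestors of the current end, so the next vertex is still isolated.\<close>

lemma chain_exists: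
  fixes E :: "('n::finite \<times> 'n) set"
  assumes dag: "acyclic E" and par: "params E (\<lambda>_. 1) \<Lambda>0"
    and anc0: "\<And>p q. \<Lambda>0 $ p $ q \<noteq> 0 \<Longrightarrow> (p, j) \<in> E\<^sup>* \<and> (q, j) \<in> E\<^sup>*"
    and j: "j \<in> W" and jx: "(j, x) \<in> {(p, q). (p, q) \<in> E \<and> q \<notin> W}\<^sup>*"
  defines "\<Sigma> \<equiv> phiG (\<lambda>_. 1)"
  shows "\<exists>\<Lambda>. params E (\<lambda>_. 1) \<Lambda> \<and> (\<forall>p q. \<Lambda> $ p $ q \<noteq> 0 \<longrightarrow> (p, x) \<in> E\<^sup>* \<and> (q, x) \<in> E\<^sup>*) \<and>
     (\<forall>p. \<Lambda> $ p $ j = \<Lambda>0 $ p $ j) \<and> (\<forall>a\<in>W. \<forall>b\<in>W. \<Sigma> \<Lambda> $ a $ b = \<Sigma> \<Lambda>0 $ a $ b) \<and>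
     (\<forall>a\<in>W. \<Sigma> \<Lambda> $ a $ x = \<Sigma> \<Lambda>0 $ a $ j) \<and> \<Sigma> \<Lambda> $ x $ x \<ge> \<Sigma> \<Lambda>0 $ j $ j"
  using jx
proof (induction rule: rtrancl_induct)
  case base
  show ?case by (rule exI[of _ \<Lambda>0]) (use par anc0 j in auto)
next
  case (step x y)
  then obtain \<Lambda> where par: "params E (\<lambda>_. 1) \<Lambda>"
    and anc: "\<And>p q. \<Lambda> $ p $ q \<noteq> 0 \<Longrightarrow> (p, x) \<in> E\<^sup>* \<and> (q, x) \<in> E\<^sup>*"
    and col: "\<And>p. \<Lambda> $ p $ j = \<Lambda>0 $ p $ j"
    and WW: "\<And>a b. a \<in> W \<Longrightarrow> b \<in> W \<Longrightarrow> \<Sigma> \<Lambda> $ a $ b = \<Sigma> \<Lambda>0 $ a $ b"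
    and Wx: "\<And>a. a \<in> W \<Longrightarrow> \<Sigma> \<Lambda> $ a $ x = \<Sigma> \<Lambda>0 $ a $ j"
    and xx: "\<Sigma> \<Lambda> $ x $ x \<ge> \<Sigma> \<Lambda>0 $ j $ j" by blast
  have xy: "(x, y) \<in> E" and y: "y \<notin> W" using step by auto
  have "(y, x) \<notin> E\<^sup>*" using xy dag by (meson acyclic_def rtrancl_into_trancl2)
  then have zero: "\<Lambda> $ p $ y = 0" "\<Lambda> $ y $ p = 0" for p using anc by blast+
  let ?L = "set_col y (\<lambda>p. if p = x then 1 else 0) \<Lambda>"
  note ext = phiG_extend[OF dag par xy zero, folded \<Sigma>_def]
  have "(p, y) \<in> E\<^sup>* \<and> (q, y) \<in> E\<^sup>*" if "?L $ p $ q \<noteq> 0" for p q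
  proof (cases "q = y")
    case True
    then show ?thesis using that xy by (auto split: if_splits)
  next
    case False
    then show ?thesis using that anc[of p q] xy by (auto intro: rtrancl_into_rtrancl)
  qed
  moreover have "?L $ p $ j = \<Lambda>0 $ p $ j" for p using col j y by (auto simp: set_col_def)
  moreover have "\<Sigma> ?L $ a $ b = \<Sigma> \<Lambda>0 $ a $ b" if "a \<in> W" "b \<in> W" for a b
    using ext(2)[of a b] WW that y by auto
  moreover have "\<Sigma> ?L $ a $ y = \<Sigma> \<Lambda>0 $ a $ j" if "a \<in> W" for a
    using ext(3)[of a] Wx that y by auto
  moreover have "\<Sigma> ?L $ y $ y \<ge> \<Sigma> \<Lambda>0 $ j $ j" using ext(4) xx by simp
  ultimately show ?case using ext(1) by blast
qed

text \<open>A directed path from \<open>j\<close> is followed until it first meets \<open>W\<close>,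
  at \<open>d\<close>. Then \<open>d\<close> is a copy of \<open>j\<close> with added error variance
  at least 1.\<close>

lemma descendant_chain:
  fixes E :: "('n::finite \<times> 'n) set"
  assumes dag: "acyclic E" and par: "params E (\<lambda>_. 1) \<Lambda>0"
    and anc0: "\<And>p q. \<Lambda>0 $ p $ q \<noteq> 0 \<Longrightarrow> (p, j) \<in> E\<^sup>* \<and> (q, j) \<in> E\<^sup>*"
    and j: "j \<in> W" and ne: "W \<inter> de E j \<noteq> {}"
  defines "\<Sigma> \<equiv> phiG (\<lambda>_. 1)"
  shows "\<exists>\<Lambda>. \<exists>d \<in> W \<inter> de E j. params E (\<lambda>_. 1) \<Lambda> \<and> (\<forall>p. \<Lambda> $ p $ j = \<Lambda>0 $ p $ j) \<and>
     (\<forall>a\<in>W - {d}. \<forall>b\<in>W - {d}. \<Sigma> \<Lambda> $ a $ b = \<Sigma> \<Lambda>0 $ a $ b) \<and>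
     (\<forall>a\<in>W - {d}. \<Sigma> \<Lambda> $ a $ d = \<Sigma> \<Lambda>0 $ a $ j) \<and> \<Sigma> \<Lambda> $ d $ d \<ge> \<Sigma> \<Lambda>0 $ j $ j + 1"
proof -
  let ?r = "{(p, q). (p, q) \<in> E \<and> q \<notin> W}"
  have hit: "(j, y) \<in> ?r\<^sup>* \<and> y \<notin> W \<or> (\<exists>d\<in>W \<inter> de E j. \<exists>x. (j, x) \<in> ?r\<^sup>* \<and> (x, d) \<in> E)"
    if "(j, y) \<in> E\<^sup>+" for y
    using that
  proof (induction rule: trancl_induct)
    case (base y)
    then show ?case by (cases "y \<in> W") (auto simp: de_def)
  next
    case (step y z)
    then have "(j, z) \<in> E\<^sup>+" by auto
    with step show ?case
      by (cases "z \<in> W") (auto simp: de_def intro: rtrancl_into_rtrancl)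
  qed
  obtain d x where d: "d \<in> W" "d \<in> de E j" and x: "(j, x) \<in> ?r\<^sup>*" and xd: "(x, d) \<in> E"
    using hit ne by (fastforce simp: de_def)
  obtain \<Lambda> where par: "params E (\<lambda>_. 1) \<Lambda>"
    and anc: "\<And>p q. \<Lambda> $ p $ q \<noteq> 0 \<Longrightarrow> (p, x) \<in> E\<^sup>* \<and> (q, x) \<in> E\<^sup>*"
    and col: "\<And>p. \<Lambda> $ p $ j = \<Lambda>0 $ p $ j"
    and WW: "\<And>a b. a \<in> W \<Longrightarrow> b \<in> W \<Longrightarrow> \<Sigma> \<Lambda> $ a $ b = \<Sigma> \<Lambda>0 $ a $ b"
    and Wx: "\<And>a. a \<in> W \<Longrightarrow> \<Sigma> \<Lambda> $ a $ x = \<Sigma> \<Lambda>0 $ a $ j"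
    and xx: "\<Sigma> \<Lambda> $ x $ x \<ge> \<Sigma> \<Lambda>0 $ j $ j"
    using chain_exists[OF dag par anc0 j x] unfolding \<Sigma>_def by blast
  have "(d, x) \<notin> E\<^sup>*" using xd dag by (meson acyclic_def rtrancl_into_trancl2)
  then have zero: "\<Lambda> $ p $ d = 0" "\<Lambda> $ d $ p = 0" for p using anc by blast+
  let ?L = "set_col d (\<lambda>p. if p = x then 1 else 0) \<Lambda>"
  note ext = phiG_extend[OF dag par xd zero, folded \<Sigma>_def]
  have "d \<noteq> j" using d(2) dag by (auto simp: de_def acyclic_def)
  then have "?L $ p $ j = \<Lambda>0 $ p $ j" for p using col by simp
  moreover have "\<Sigma> ?L $ a $ b = \<Sigma> \<Lambda>0 $ a $ b" if "a \<in> W - {d}" "b \<in> W - {d}" for a b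
    using ext(2)[of a b] WW that by auto
  moreover have "\<Sigma> ?L $ a $ d = \<Sigma> \<Lambda>0 $ a $ j" if "a \<in> W - {d}" for a
    using ext(3)[of a] Wx that by auto
  moreover have "\<Sigma> ?L $ d $ d \<ge> \<Sigma> \<Lambda>0 $ j $ j + 1" using ext(4) xx by simp
  ultimately show ?thesis using ext(1) d by blast
qed

lemma ccov_uncorrelated:
  assumes "spd M" "a \<notin> K" "\<And>k. k \<in> K \<Longrightarrow> M $ k $ a = 0"
  shows "ccov M K a b = M $ b $ a"
proof -
  have Ma: "(M *v axis a 1) $ x = M $ x $ a" for x
    by (simp add: matrix_vector_mul_component inner_axis)
  then have "is_resid M K a (axis a 1)"
    using assms by (simp add: is_resid_def axis_def)
  then show ?thesis using ccov_eq[OF assms(1,2)] Ma by metis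
qed

text \<open>Conditioning on \<open>K - {d}\<close> first changes nothing for \<open>a\<close> and
  \<open>d\<close>, so a single recursion step remains.\<close>

lemma ccov_single:
  assumes spd: "spd M" and "a \<notin> K" "d \<in> K"
    and zero: "\<And>k. k \<in> K - {d} \<Longrightarrow> M $ k $ a = 0" "\<And>k. k \<in> K - {d} \<Longrightarrow> M $ k $ d = 0"
  shows "ccov M K a b = M $ b $ a - M $ d $ a * M $ b $ d / M $ d $ d"
proof -
  have "K = insert d (K - {d})" using assms(3) by auto
  moreover have "ccov M (insert d (K - {d})) a b = M $ b $ a - M $ d $ a * M $ b $ d / M $ d $ d"
  proof -
    have "ccov M (K - {d}) a x = M $ x $ a" "ccov M (K - {d}) d x = M $ x $ d" for x
      using assms by (auto intro!: ccov_uncorrelated[OF spd])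
    then show ?thesis using assms ccov_insert[OF spd, of d "K - {d}" a b] by auto
  qed
  ultimately show ?thesis by simp
qed

section \<open>Adjustment sets for variances and edge coefficients\<close>

text \<open>Under these conditions on \<open>A\<close>, the residual of \<open>i\<close> given
  \<open>A\<close> is the error of \<open>i\<close>.\<close>

lemma omega_c_sufficient:
  fixes E :: "('n::finite \<times> 'n) set"
  assumes dag: "acyclic E" and par: "params E \<omega> \<Lambda>" and "pa E i \<subseteq> A" "A \<subseteq> UNIV - deb E i"
  shows "omega_c i A (phiG \<omega> \<Lambda>) = \<omega> i"
proof -
  let ?S = "phiG \<omega> \<Lambda>"
  have sup: "supported E \<Lambda>" using par by (simp add: params_iff)
  have spd: "spd ?S" by (rule spd_phiG[OF dag par])
  have iA: "i \<notin> A" using assms(4) by (auto simp: deb_def)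
  \<comment> \<open>Column \<open>i\<close> of \<open>mat 1 - \<Lambda>\<close>: the coefficients
    that express the error of \<open>i\<close> through the variables.\<close>
  define u :: "real^'n" where "u = (\<chi> x. (if x = i then 1 else 0) - \<Lambda> $ x $ i)"
  have Su: "(?S *v u) $ x = \<omega> i * effects \<Lambda> $ i $ x" for x
  proof -
    have "(?S *v u) $ x = (\<Sum>y\<in>UNIV. (if y = i then ?S $ x $ i else 0) - ?S $ x $ y * \<Lambda> $ y $ i)"
      unfolding matrix_vector_mult_def u_def vec_lambda_beta
      by (intro sum.cong refl) (auto simp: algebra_simps)
    then show ?thesis using phiG_rec[OF dag sup, of \<omega> x i] by (simp add: sum_subtractf)
  qed
  have "(i, i) \<notin> E" using acyclic_asym[OF dag] by blast
  then have "\<Lambda> $ i $ i = 0" using par by (simp add: params_def)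
  moreover have "\<Lambda> $ x $ i = 0" if "x \<notin> A" for x
    using that assms(3) par by (auto simp: params_def pa_def)
  moreover have "effects \<Lambda> $ i $ k = 0" if "k \<in> A" for k
    using that assms(4) effects_nonzero[OF dag sup, of i k]
    by (auto simp: deb_def de_def rtrancl_eq_or_trancl)
  ultimately have "is_resid ?S A i u"
    by (auto simp: is_resid_def Su) (auto simp: u_def)
  then show ?thesis
    using omega_c_eq[OF spd iA] ccov_eq[OF spd iA] Su effects_diag[OF dag sup] by simp
qed

text \<open>The common error variance \<open>c\<close> stays free in order to tell a covariance from
  a regression coefficient.\<close>

lemma single_edge:
  fixes E :: "('n::finite \<times> 'n) set" and i j :: 'n
  assumes dag: "acyclic E" and ij: "(i, j) \<in> E" and c: "c > 0"
  defines "\<Lambda> \<equiv> set_col j (\<lambda>p. if p = i then 1 else 0) (0 :: real^'n^'n)"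
  shows "params E (\<lambda>_. c) \<Lambda>"
    and "a \<noteq> j \<Longrightarrow> b \<noteq> j \<Longrightarrow> phiG (\<lambda>_. c) \<Lambda> $ a $ b = (if a = b then c else 0)"
    and "a \<noteq> j \<Longrightarrow> phiG (\<lambda>_. c) \<Lambda> $ a $ j = (if a = i then c else 0)"
    and "a \<noteq> j \<Longrightarrow> phiG (\<lambda>_. c) \<Lambda> $ j $ a = (if a = i then c else 0)"
    and "phiG (\<lambda>_. c) \<Lambda> $ j $ j = 2 * c"
proof -
  have p: "params E (\<lambda>_. c) 0" using c by (simp add: params_def)
  note ext = phiG_extend[OF dag p ij, folded \<Lambda>_def]
  show "params E (\<lambda>_. c) \<Lambda>" by (rule ext) simp_all
  show "phiG (\<lambda>_. c) \<Lambda> $ a $ b = (if a = b then c else 0)" if "a \<noteq> j" "b \<noteq> j" for a b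
    using ext(2)[of a b] that by (simp add: phiG_zero)
  show *: "phiG (\<lambda>_. c) \<Lambda> $ a $ j = (if a = i then c else 0)" if "a \<noteq> j" for a
    using ext(3)[of a] that by (simp add: phiG_zero)
  show "phiG (\<lambda>_. c) \<Lambda> $ j $ a = (if a = i then c else 0)" if "a \<noteq> j" for a
    using *[OF that] phiG_sym[of _ \<Lambda> j a] by simp
  show "phiG (\<lambda>_. c) \<Lambda> $ j $ j = 2 * c"
    using ext(4) by (simp add: phiG_zero)
qed

lemma omega_c_necessary:
  fixes E :: "('n::finite \<times> 'n) set"
  assumes dag: "acyclic E" and iA: "i \<notin> A"
    and eq: "\<And>\<omega> \<Lambda>. params E \<omega> \<Lambda> \<Longrightarrow> omega_c i A (phiG \<omega> \<Lambda>) = \<omega> i"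
  shows "pa E i \<subseteq> A \<and> A \<subseteq> UNIV - deb E i"
proof
  show "pa E i \<subseteq> A"
  proof (rule ccontr)
    assume "\<not> pa E i \<subseteq> A"
    \<comment> \<open>With a single edge, from the omitted parent \<open>p\<close>, the vertex
      \<open>i\<close> is uncorrelated with \<open>A\<close> and has variance 2 instead of
      1.\<close>
    then obtain p where p: "(p, i) \<in> E" "p \<notin> A" by (auto simp: pa_def)
    note e = single_edge[OF dag p(1) zero_less_one]
    have spd: "spd (phiG (\<lambda>_. 1) (set_col i (\<lambda>q. if q = p then 1 else 0) 0))"
      by (rule spd_phiG[OF dag e(1)])
    have "ccov (phiG (\<lambda>_. 1) (set_col i (\<lambda>q. if q = p then 1 else 0) 0)) A i i = 2"
    proof (subst ccov_uncorrelated[OF spd iA])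
      fix k assume "k \<in> A"
      then have "k \<noteq> i" "k \<noteq> p" using iA p by auto
      then show "phiG (\<lambda>_. 1) (set_col i (\<lambda>q. if q = p then 1 else 0) 0) $ k $ i = 0"
        using e(3)[of k] by simp
    qed (use e(5) in simp)
    then show False using eq[OF e(1)] omega_c_eq[OF spd iA] by simp
  qed
  show "A \<subseteq> UNIV - deb E i"
  proof (rule ccontr)
    assume "\<not> A \<subseteq> UNIV - deb E i"
    then have ne: "insert i A \<inter> de E i \<noteq> {}" using iA by (auto simp: deb_def)
    \<comment> \<open>Starting from independent variables, some \<open>d\<close> in \<open>A\<close>
      becomes a noisy copy of \<open>i\<close>; conditioning on it lowers the variance of
      \<open>i\<close> below 1.\<close>
    have p: "params E (\<lambda>_. 1) 0" by (simp add: params_def)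
    obtain \<Lambda> d where d: "d \<in> insert i A" "d \<in> de E i" and par: "params E (\<lambda>_. 1) \<Lambda>"
      and 1: "\<And>a b. a \<in> insert i A - {d} \<Longrightarrow> b \<in> insert i A - {d} \<Longrightarrow>
         phiG (\<lambda>_. 1) \<Lambda> $ a $ b = phiG (\<lambda>_. 1) 0 $ a $ b"
      and 2: "\<And>a. a \<in> insert i A - {d} \<Longrightarrow> phiG (\<lambda>_. 1) \<Lambda> $ a $ d = phiG (\<lambda>_. 1) 0 $ a $ i"
      and 3: "phiG (\<lambda>_. 1) \<Lambda> $ d $ d \<ge> phiG (\<lambda>_. 1) 0 $ i $ i + 1"
      using descendant_chain[OF dag p _ _ ne] by force
    have spd: "spd (phiG (\<lambda>_. 1) \<Lambda>)" by (rule spd_phiG[OF dag par])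
    have di: "d \<noteq> i" using d(2) dag by (auto simp: de_def acyclic_def)
    have dA: "d \<in> A" using d di by auto
    have id: "phiG (\<lambda>_. 1) \<Lambda> $ i $ d = 1" using 2[of i] di by (simp add: phiG_zero)
    have "ccov (phiG (\<lambda>_. 1) \<Lambda>) A i i = phiG (\<lambda>_. 1) \<Lambda> $ i $ i
        - phiG (\<lambda>_. 1) \<Lambda> $ d $ i * phiG (\<lambda>_. 1) \<Lambda> $ i $ d / phiG (\<lambda>_. 1) \<Lambda> $ d $ d"
      by (rule ccov_single[OF spd iA dA]) (use 1 2 di iA in \<open>auto simp: phiG_zero\<close>)
    also have "\<dots> = 1 - 1 / phiG (\<lambda>_. 1) \<Lambda> $ d $ d"
      using 1[of i i] di id phiG_sym[of _ \<Lambda> d i] by (simp add: phiG_zero)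
    also have "\<dots> \<noteq> 1" using 3 by (simp add: phiG_zero)
    finally show False using eq[OF par] omega_c_eq[OF spd iA] by simp
  qed
qed

lemma lambda_c_necessary:
  fixes E :: "('n::finite \<times> 'n) set"
  assumes dag: "acyclic E" and ij: "(i, j) \<in> E" and jA: "j \<notin> A"
    and eq: "\<And>\<omega> \<Lambda>. params E \<omega> \<Lambda> \<Longrightarrow> lambda_c i j A (phiG \<omega> \<Lambda>) = \<Lambda> $ i $ j"
  shows "i \<in> A \<and> A \<subseteq> UNIV - deb E j"
proof
  have neq: "i \<noteq> j" using ij acyclic_asym[OF dag] by blast
  define L where "L = set_col j (\<lambda>p. if p = i then 1 else 0) (0 :: real^'n^'n)"
  note e = single_edge[OF dag ij, folded L_def]
  have Lij: "L $ i $ j = 1" by (simp add: L_def)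
  show iA: "i \<in> A"
  proof (rule ccontr)
    assume iA: "i \<notin> A"
    \<comment> \<open>For \<open>i\<close> outside \<open>A\<close> the quantity is a covariance,
      here 2, while the edge coefficient is 1.\<close>
    have par: "params E (\<lambda>_. 2) L" by (rule e(1)) simp
    have spd: "spd (phiG (\<lambda>_. 2) L)" by (rule spd_phiG[OF dag par])
    have "ccov (phiG (\<lambda>_. 2) L) A i j = phiG (\<lambda>_. 2) L $ j $ i"
    proof (rule ccov_uncorrelated[OF spd iA])
      fix k assume "k \<in> A"
      then have "k \<noteq> i" "k \<noteq> j" using iA jA by auto
      then show "phiG (\<lambda>_. 2) L $ k $ i = 0" using e(2)[of 2 k i] neq by simp
    qed
    also have "\<dots> = 2" using e(4)[of 2 i] neq by simp
    finally show False using eq[OF par] lambda_c_eq_notin[OF spd iA jA] Lij by simp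
  qed
  show "A \<subseteq> UNIV - deb E j"
  proof (rule ccontr)
    assume "\<not> A \<subseteq> UNIV - deb E j"
    then have ne: "insert j A \<inter> de E j \<noteq> {}" using jA by (auto simp: deb_def)
    \<comment> \<open>A noisy copy \<open>d\<close> of \<open>j\<close> in \<open>A\<close> distorts
      the coefficient 1 of the edge: with \<open>D = S $ d $ d\<close> it becomes
      \<open>(1 - 2 / D) / (1 - 1 / D)\<close>.\<close>
    have par0: "params E (\<lambda>_. 1) L" by (rule e(1)) simp
    have anc: "(p, j) \<in> E\<^sup>* \<and> (q, j) \<in> E\<^sup>*" if "L $ p $ q \<noteq> 0" for p q
      using that ij by (auto simp: L_def set_col_def split: if_splits)
    define S0 where "S0 = phiG (\<lambda>_. 1) L"
    have "\<exists>\<Lambda>. \<exists>d. d \<in> insert j A \<inter> de E j \<and> params E (\<lambda>_. 1) \<Lambda> \<and> (\<forall>p. \<Lambda> $ p $ j = L $ p $ j) \<and>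
        (\<forall>a\<in>insert j A - {d}. \<forall>b\<in>insert j A - {d}. phiG (\<lambda>_. 1) \<Lambda> $ a $ b = S0 $ a $ b) \<and>
        (\<forall>a\<in>insert j A - {d}. phiG (\<lambda>_. 1) \<Lambda> $ a $ d = S0 $ a $ j) \<and>
        S0 $ j $ j + 1 \<le> phiG (\<lambda>_. 1) \<Lambda> $ d $ d"
      using descendant_chain[OF dag par0 anc insertI1 ne, folded S0_def] unfolding Bex_def .
    then obtain \<Lambda> d where dd: "d \<in> insert j A \<inter> de E j" and par: "params E (\<lambda>_. 1) \<Lambda>"
      and \<Lambda>: "\<forall>p. \<Lambda> $ p $ j = L $ p $ j"
      and S1: "\<forall>a\<in>insert j A - {d}. \<forall>b\<in>insert j A - {d}. phiG (\<lambda>_. 1) \<Lambda> $ a $ b = S0 $ a $ b"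
      and S2: "\<forall>a\<in>insert j A - {d}. phiG (\<lambda>_. 1) \<Lambda> $ a $ d = S0 $ a $ j"
      and 3: "phiG (\<lambda>_. 1) \<Lambda> $ d $ d \<ge> S0 $ j $ j + 1"
      by (elim exE conjE) (rule that)
    have d: "d \<in> insert j A" "d \<in> de E j" using dd by auto
    note 1 = S1[rule_format] and 2 = S2[rule_format]
    define S where "S = phiG (\<lambda>_. 1) \<Lambda>"
    have spd: "spd S" unfolding S_def by (rule spd_phiG[OF dag par])
    have "d \<noteq> j" using d(2) dag by (auto simp: de_def acyclic_def)
    moreover have "d \<noteq> i"
      using d(2) dag ij by (auto simp: de_def acyclic_def dest: trancl_into_trancl)
    ultimately have dK: "d \<in> A - {i}" "i \<in> insert j A - {d}" "j \<in> insert j A - {d}"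
      using d iA by auto
    have S0: "S0 $ a $ b = (if a = b then 1 else 0)" "S0 $ a $ j = (if a = i then 1 else 0)"
       "S0 $ j $ a = (if a = i then 1 else 0)"
      if "a \<noteq> j" "b \<noteq> j" for a b
      using e(2-4)[of 1] that by (auto simp: S0_def)
    have S0jj: "S0 $ j $ j = 2" using e(5)[of 1] by (simp add: S0_def)
    have vals: "S $ i $ i = 1" "S $ j $ i = 1" "S $ i $ d = 1" "S $ j $ d = 2" "S $ d $ d \<ge> 3" "S $ d $ i = 1"
      using 1[OF dK(2,2)] 1[OF dK(3,2)] 2[OF dK(2)] 2[OF dK(3)] 3 neq phiG_sym[of _ \<Lambda> d i]
      by (auto simp: S_def S0 S0jj)
    have zero: "S $ k $ i = 0" "S $ k $ d = 0" if "k \<in> A - {i} - {d}" for k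
      using 1[OF _ dK(2), of k] 2[of k] that jA S0[of k i] neq by (auto simp: S_def)
    have c: "ccov S (A - {i}) i b = S $ b $ i - S $ d $ i * S $ b $ d / S $ d $ d" for b
      by (rule ccov_single[OF spd _ dK(1)]) (use zero in auto)
    have "ccov S (A - {i}) i j \<noteq> ccov S (A - {i}) i i"
      unfolding c using vals by (simp add: field_simps)
    moreover have "ccov S (A - {i}) i i \<noteq> 0" using ccov_pos[OF spd, of i "A - {i}"] by simp
    ultimately have "lambda_c i j A S \<noteq> 1" using lambda_c_eq_in[OF spd iA jA] by simp
    then show False using eq[OF par] \<Lambda> Lij by (simp add: S_def)
  qed
qed

lemma Gdel_subset: "Gdel E i j \<subseteq> E"
  by (auto simp: Gdel_def)

text \<open>Both models agree on the vertices outside \<open>deb E j\<close>, and passing to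
  \<open>Gdel E i j\<close> removes exactly the term of \<open>i\<close> from the structural
  equation of \<open>j\<close>.\<close>

lemma lambda_c_Gdel:
  fixes E :: "('n::finite \<times> 'n) set"
  assumes dag: "acyclic E" and ij: "(i, j) \<in> E" and iA: "i \<in> A" and A: "A \<subseteq> UNIV - deb E j"
    and par: "params E \<omega> \<Lambda>"
  defines "\<Lambda>' \<equiv> (\<chi> x y. if (x, y) \<in> Gdel E i j then \<Lambda> $ x $ y else 0)"
  shows "lambda_c i j A (phiG \<omega> \<Lambda>) = \<Lambda> $ i $ j +
    ccov (phiG \<omega> \<Lambda>') (A - {i}) i j / ccov (phiG \<omega> \<Lambda>') (A - {i}) i i"
    and "params (Gdel E i j) \<omega> \<Lambda>'"
proof -
  let ?K = "A - {i}"
  show par': "params (Gdel E i j) \<omega> \<Lambda>'" using par by (auto simp: params_def \<Lambda>'_def)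
  then have parE: "params E \<omega> \<Lambda>'" using Gdel_subset[of E i j] by (auto simp: params_def)
  have spd: "spd (phiG \<omega> \<Lambda>)" "spd (phiG \<omega> \<Lambda>')" using spd_phiG[OF dag] par parE by auto
  have K: "i \<notin> ?K" by simp
  have nd: "insert i ?K \<inter> deb E j = {}" using iA A by auto
  \<comment> \<open>The complement of \<open>deb E j\<close> is closed under parents, so
    coefficients of edges into \<open>deb E j\<close> do not affect the covariances on it.\<close>
  have anc: "p \<in> - deb E j" if "(p, y) \<in> E" "y \<in> - deb E j" for p y
    using that by (auto simp: deb_def de_def intro: trancl_into_trancl)
  have phi: "phiG \<omega> \<Lambda> $ x $ y = phiG \<omega> \<Lambda>' $ x $ y" if "x \<in> - deb E j" "y \<in> - deb E j" for x y
  proof (rule phiG_cong[OF dag _ _ anc _ that])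
    show "\<Lambda> $ p $ y = \<Lambda>' $ p $ y" if "y \<in> - deb E j" for p y
    proof (cases "(p, y) \<in> E")
      case True
      then have "(p, y) \<in> Gdel E i j" using anc[OF True that] that by (auto simp: Gdel_def deb_def)
      then show ?thesis by (simp add: \<Lambda>'_def)
    next
      case False
      then show ?thesis using par parE by (simp add: params_def)
    qed
  qed (use par parE in \<open>auto simp: params_iff\<close>)
  have cc: "ccov (phiG \<omega> \<Lambda>) ?K i p = ccov (phiG \<omega> \<Lambda>') ?K i p" if "p \<notin> deb E j" for p
    by (rule ccov_cong[OF spd K], rule phi) (use that nd in auto)
  have i: "i \<notin> deb E j" using nd by auto
  have "ccov (phiG \<omega> \<Lambda>) ?K i j = (\<Sum>p\<in>UNIV. \<Lambda> $ p $ j * ccov (phiG \<omega> \<Lambda>) ?K i p)"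
    by (rule ccov_nondesc[OF dag par K nd])
  also have "\<dots> = (\<Sum>p\<in>UNIV. (if p = i then \<Lambda> $ i $ j * ccov (phiG \<omega> \<Lambda>') ?K i i else 0)
      + \<Lambda>' $ p $ j * ccov (phiG \<omega> \<Lambda>') ?K i p)"
  proof (intro sum.cong refl)
    fix p
    show "\<Lambda> $ p $ j * ccov (phiG \<omega> \<Lambda>) ?K i p =
      (if p = i then \<Lambda> $ i $ j * ccov (phiG \<omega> \<Lambda>') ?K i i else 0)
      + \<Lambda>' $ p $ j * ccov (phiG \<omega> \<Lambda>') ?K i p"
    proof (cases "(p, j) \<in> E")
      case True
      have "p \<notin> deb E j" "j \<notin> de E j"
        using True dag unfolding deb_def de_def acyclic_def
        by (auto dest: trancl_into_trancl)
      then show ?thesis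
        using True cc[of p] by (auto simp: \<Lambda>'_def Gdel_def deb_def)
    next
      case False
      then show ?thesis using par parE ij by (auto simp: params_def)
    qed
  qed
  also have "\<dots> = \<Lambda> $ i $ j * ccov (phiG \<omega> \<Lambda>') ?K i i + ccov (phiG \<omega> \<Lambda>') ?K i j"
    unfolding sum.distrib ccov_nondesc[OF dag parE K nd] by simp
  finally have "ccov (phiG \<omega> \<Lambda>) ?K i j =
      \<Lambda> $ i $ j * ccov (phiG \<omega> \<Lambda>') ?K i i + ccov (phiG \<omega> \<Lambda>') ?K i j" .
  moreover have "j \<notin> A" using A by (auto simp: deb_def)
  moreover have "ccov (phiG \<omega> \<Lambda>') ?K i i \<noteq> 0" using ccov_pos[OF spd(2) K] by simp
  ultimately show "lambda_c i j A (phiG \<omega> \<Lambda>) = \<Lambda> $ i $ j +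
    ccov (phiG \<omega> \<Lambda>') (A - {i}) i j / ccov (phiG \<omega> \<Lambda>') (A - {i}) i i"
    using lambda_c_eq_in[OF spd(1) iA] cc[OF i] by (simp add: field_simps)
qed

theorem theorem3p3:
  fixes E :: "('n::finite \<times> 'n) set"
  assumes dag: "acyclic E"
  shows "(\<forall>i A. i \<notin> A \<longrightarrow>
            ((\<forall>\<omega> \<Lambda>. params E \<omega> \<Lambda> \<longrightarrow> omega_c i A (phiG \<omega> \<Lambda>) = \<omega> i)
              \<longleftrightarrow> pa E i \<subseteq> A \<and> A \<subseteq> UNIV - deb E i))
       \<and> (\<forall>i j A. i \<noteq> j \<and> (i, j) \<notin> E \<and> j \<notin> A \<longrightarrow>
            ((\<forall>\<Sigma>\<in>modelG E. lambda_c i j A \<Sigma> = 0)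
              \<longleftrightarrow> dsep E (A - {i}) {i} {j}))
       \<and> (\<forall>i j A. (i, j) \<in> E \<and> j \<notin> A \<longrightarrow>
            ((\<forall>\<omega> \<Lambda>. params E \<omega> \<Lambda> \<longrightarrow> lambda_c i j A (phiG \<omega> \<Lambda>) = \<Lambda> $ i $ j)
              \<longleftrightarrow> i \<in> A \<and> A \<subseteq> UNIV - deb E j \<and> dsep (Gdel E i j) (A - {i}) {i} {j}))"
proof (intro conjI allI impI)
  fix i :: 'n and A assume "i \<notin> A"
  then show "(\<forall>\<omega> \<Lambda>. params E \<omega> \<Lambda> \<longrightarrow> omega_c i A (phiG \<omega> \<Lambda>) = \<omega> i)
              \<longleftrightarrow> pa E i \<subseteq> A \<and> A \<subseteq> UNIV - deb E i"
    using omega_c_necessary[OF dag] omega_c_sufficient[OF dag] by blast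
next
  fix i j :: 'n and A assume "i \<noteq> j \<and> (i, j) \<notin> E \<and> j \<notin> A"
  then have a: "i \<noteq> j" "j \<notin> A" by auto
  have "(\<forall>\<Sigma>\<in>modelG E. lambda_c i j A \<Sigma> = 0) \<longleftrightarrow>
      (\<forall>\<omega> \<Lambda>. params E \<omega> \<Lambda> \<longrightarrow> lambda_c i j A (phiG \<omega> \<Lambda>) = 0)"
    unfolding modelG_def by blast
  also have "\<dots> \<longleftrightarrow> (\<forall>\<omega> \<Lambda>. params E \<omega> \<Lambda> \<longrightarrow> ccov (phiG \<omega> \<Lambda>) (A - {i}) i j = 0)"
    using lambda_c_zero_iff[OF spd_phiG[OF dag] a(2,1)] by blast
  also have "\<dots> \<longleftrightarrow> dsep E (A - {i}) {i} {j}"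
    using dsep_iff_ccov_zero[OF dag a(1), of "A - {i}"] a(2) by blast
  finally show "(\<forall>\<Sigma>\<in>modelG E. lambda_c i j A \<Sigma> = 0) \<longleftrightarrow> dsep E (A - {i}) {i} {j}" .
next
  fix i j :: 'n and A assume "(i, j) \<in> E \<and> j \<notin> A"
  then have ij: "(i, j) \<in> E" and jA: "j \<notin> A" by auto
  have neq: "i \<noteq> j" using ij acyclic_asym[OF dag] by blast
  have dag': "acyclic (Gdel E i j)" by (rule acyclic_subset[OF dag Gdel_subset])
  have "(\<forall>\<omega> \<Lambda>. params E \<omega> \<Lambda> \<longrightarrow> lambda_c i j A (phiG \<omega> \<Lambda>) = \<Lambda> $ i $ j)
      \<longleftrightarrow> dsep (Gdel E i j) (A - {i}) {i} {j}" if iA: "i \<in> A" and A: "A \<subseteq> UNIV - deb E j"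
  proof
    assume eq: "\<forall>\<omega> \<Lambda>. params E \<omega> \<Lambda> \<longrightarrow> lambda_c i j A (phiG \<omega> \<Lambda>) = \<Lambda> $ i $ j"
    \<comment> \<open>Parameters of the smaller graph are parameters of \<open>E\<close> with
      coefficient 0 on the edge from \<open>i\<close> to \<open>j\<close>, so on them the assumed
      identity says that \<open>lambda_c\<close> vanishes.\<close>
    have "ccov (phiG \<omega> \<Lambda>) (A - {i}) i j = 0" if p: "params (Gdel E i j) \<omega> \<Lambda>" for \<omega> \<Lambda>
    proof -
      have pE: "params E \<omega> \<Lambda>" using p Gdel_subset[of E i j] by (auto simp: params_def)
      moreover have "\<Lambda> $ i $ j = 0" using p by (auto simp: params_def Gdel_def)
      ultimately have "lambda_c i j A (phiG \<omega> \<Lambda>) = 0" using eq by simp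
      then show ?thesis using lambda_c_zero_iff[OF spd_phiG[OF dag pE] jA neq] by simp
    qed
    then show "dsep (Gdel E i j) (A - {i}) {i} {j}"
      using dsep_iff_ccov_zero[OF dag' neq, of "A - {i}"] jA by blast
  next
    assume "dsep (Gdel E i j) (A - {i}) {i} {j}"
    then have zero: "\<And>\<omega> \<Lambda>. params (Gdel E i j) \<omega> \<Lambda> \<Longrightarrow> ccov (phiG \<omega> \<Lambda>) (A - {i}) i j = 0"
      using dsep_iff_ccov_zero[OF dag' neq, of "A - {i}"] jA by blast
    show "\<forall>\<omega> \<Lambda>. params E \<omega> \<Lambda> \<longrightarrow> lambda_c i j A (phiG \<omega> \<Lambda>) = \<Lambda> $ i $ j"
      using lambda_c_Gdel[OF dag ij iA A] zero by simp
  qed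
  then show "(\<forall>\<omega> \<Lambda>. params E \<omega> \<Lambda> \<longrightarrow> lambda_c i j A (phiG \<omega> \<Lambda>) = \<Lambda> $ i $ j)
      \<longleftrightarrow> i \<in> A \<and> A \<subseteq> UNIV - deb E j \<and> dsep (Gdel E i j) (A - {i}) {i} {j}"
    using lambda_c_necessary[OF dag ij jA] by blast
qed

end
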